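(* Let $H$ be a graph and let $k,t>0$ be integers. Let $\mathcal{C}$ be the class of all graphs that contain neither $P_k$ nor $K_{t,t}$ as an induced subgraph. Let $Q\subseteq \mathcal{P}(V(H))$ be a family of subsets of $V(H)$, quasi-ordered by $A\le B$ iff $B\subseteq A$. Then, up to isomorphism of labeled graphs, there are only finitely many $\le_l$-minimal $Q$-labeled graphs in $\mathcal{C}(Q)$ that are not $H$-list-colorable, and likewise only finitely many $\subseteq_l$-minimal $Q$-labeled graphs in $\mathcal{C}(Q)$ that are not $H$-list-colorable.
   Context: All graphs are finite, simple. $P_k$ is the path on $k$ vertices and $K_{t,t}$ the complete bipartite graph with $t$ vertices on each side. A $Q$-labeled graph is a pair $(G,f)$ with $G$ a graph and $f:V(G)\to Q$; $\mathcal{C}(Q)$ is the class of $Q$-labeled graphs $(G,f)$ with $G\in\mathcal{C}$. A $Q$-labeled graph $(G,f)$ is $H$-list-colorable if there is a map $\varphi:V(G)\to V(H)$ with $\varphi(u)\varphi(v)\in E(H)$ for every edge $uv\in E(G)$ and $\varphi(v)\in f(v)$ for every $v\in V(G)$ (i.e. $f(v)$ is the list of admissible colors of $v$). For $Q$-labeled graphs, $(G,f)\le_l (G',f')$ means there is an injective map $\sigma:V(G)\to V(G')$ such that $uv\in E(G)\iff \sigma(u)\sigma(v)\in E(G')$ (so $G$ is an induced subgraph of $G'$) and $f(v)\le f'(\sigma(v))$ (i.e. $f'(\sigma(v))\subseteq f(v)$) for all $v$; $(G,f)\subseteq_l (G',f')$ means there is an injective $\sigma$ with $uv\in E(G)\implies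 \sigma(u)\sigma(v)\in E(G')$ (so $G$ is a subgraph of $G'$) and $f(v)\le f'(\sigma(v))$ for all $v$. For a relation $r$ and property $P$, a labeled graph with property $P$ is $r$-minimal if no labeled graph strictly smaller than it with respect to $r$ has property $P$; here the property is "belongs to $\mathcal{C}(Q)$ and is not $H$-list-colorable". *)

theory Defs
  imports Main
begin

record 'a ugraph =
  verts :: "'a set"
  edges :: "'a set set"

definition simple_graph :: "'a ugraph \<Rightarrow> bool" where
  "simple_graph G \<longleftrightarrow> finite (verts G) \<and> (\<forall>e\<in>edges G. e \<subseteq> verts G \<and> card e = 2)"

definition subgraph_emb :: "('a \<Rightarrow> 'b) \<Rightarrow> 'a ugraph \<Rightarrow> 'b ugraph \<Rightarrow> bool" where
  "subgraph_emb \<sigma> G G' \<longleftrightarrow>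
     \<sigma> ` verts G \<subseteq> verts G' \<and> inj_on \<sigma> (verts G) \<and>
     (\<forall>u\<in>verts G. \<forall>v\<in>verts G. {u, v} \<in> edges G \<longrightarrow> {\<sigma> u, \<sigma> v} \<in> edges G')"

definition induced_emb :: "('a \<Rightarrow> 'b) \<Rightarrow> 'a ugraph \<Rightarrow> 'b ugraph \<Rightarrow> bool" where
  "induced_emb \<sigma> G G' \<longleftrightarrow>
     \<sigma> ` verts G \<subseteq> verts G' \<and> inj_on \<sigma> (verts G) \<and>
     (\<forall>u\<in>verts G. \<forall>v\<in>verts G. {u, v} \<in> edges G \<longleftrightarrow> {\<sigma> u, \<sigma> v} \<in> edges G')"

definition has_induced :: "'b ugraph \<Rightarrow> 'a ugraph \<Rightarrow> bool" where
  "has_induced G F \<longleftrightarrow> (\<exists>\<sigma>. induced_emb \<sigma> F G)"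

text \<open>The path on \<open>k\<close> vertices (not \<open>k\<close> edges).\<close>

definition path_graph :: "nat \<Rightarrow> nat ugraph" where
  "path_graph k = \<lparr>verts = {..<k}, edges = {{i, Suc i} | i. Suc i < k}\<rparr>"

definition complete_bipartite :: "nat \<Rightarrow> (nat + nat) ugraph" where
  "complete_bipartite t =
     \<lparr>verts = {..<t} <+> {..<t}, edges = {{Inl i, Inr j} | i j. i < t \<and> j < t}\<rparr>"

definition path_biclique_free :: "nat \<Rightarrow> nat \<Rightarrow> 'a ugraph set" where
  "path_biclique_free k t =
     {G. simple_graph G \<and> \<not> has_induced G (path_graph k) \<and> \<not> has_induced G (complete_bipartite t)}"

text \<open>The labeling is a total function; its values outside the vertex set are irrelevant,
  and every notion below ignores them.\<close>

type_synonym ('a, 'q) lgraph = "'a ugraph \<times> ('a \<Rightarrow> 'q)"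

definition labeled_class :: "'a ugraph set \<Rightarrow> 'q set \<Rightarrow> ('a, 'q) lgraph set" where
  "labeled_class C Q = {(G, f). G \<in> C \<and> f ` verts G \<subseteq> Q}"

definition lgraph_induced_le ::
    "('q \<Rightarrow> 'q \<Rightarrow> bool) \<Rightarrow> ('a, 'q) lgraph \<Rightarrow> ('b, 'q) lgraph \<Rightarrow> bool" where
  "lgraph_induced_le le X Y \<longleftrightarrow>
     (\<exists>\<sigma>. induced_emb \<sigma> (fst X) (fst Y) \<and> (\<forall>v\<in>verts (fst X). le (snd X v) (snd Y (\<sigma> v))))"

definition lgraph_subgraph_le ::
    "('q \<Rightarrow> 'q \<Rightarrow> bool) \<Rightarrow> ('a, 'q) lgraph \<Rightarrow> ('b, 'q) lgraph \<Rightarrow> bool" where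
  "lgraph_subgraph_le le X Y \<longleftrightarrow>
     (\<exists>\<sigma>. subgraph_emb \<sigma> (fst X) (fst Y) \<and> (\<forall>v\<in>verts (fst X). le (snd X v) (snd Y (\<sigma> v))))"

definition lgraph_iso :: "('a, 'q) lgraph \<Rightarrow> ('b, 'q) lgraph \<Rightarrow> bool" where
  "lgraph_iso X Y \<longleftrightarrow>
     (\<exists>\<sigma>. bij_betw \<sigma> (verts (fst X)) (verts (fst Y)) \<and>
        (\<forall>u\<in>verts (fst X). \<forall>v\<in>verts (fst X).
           {u, v} \<in> edges (fst X) \<longleftrightarrow> {\<sigma> u, \<sigma> v} \<in> edges (fst Y)) \<and>
        (\<forall>v\<in>verts (fst X). snd X v = snd Y (\<sigma> v)))"

definition lgraph_iso_rel :: "(('a, 'q) lgraph \<times> ('a, 'q) lgraph) set" where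
  "lgraph_iso_rel = {(X, Y). lgraph_iso X Y}"

definition list_le :: "'h set \<Rightarrow> 'h set \<Rightarrow> bool" where
  "list_le A B \<longleftrightarrow> B \<subseteq> A"

definition list_colorable :: "'h ugraph \<Rightarrow> ('a, 'h set) lgraph \<Rightarrow> bool" where
  "list_colorable H X \<longleftrightarrow>
     (\<exists>\<phi>. \<phi> ` verts (fst X) \<subseteq> verts H \<and>
        (\<forall>u\<in>verts (fst X). \<forall>v\<in>verts (fst X).
           {u, v} \<in> edges (fst X) \<longrightarrow> {\<phi> u, \<phi> v} \<in> edges H) \<and>
        (\<forall>v\<in>verts (fst X). \<phi> v \<in> snd X v))"

text \<open>For a quasi-order \<open>r\<close>, \<open>Y\<close> is strictly smaller than \<open>X\<close> if \<open>r Y X\<close> but not \<open>r X Y\<close>.\<close>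

definition minimal_wrt :: "('x \<Rightarrow> 'x \<Rightarrow> bool) \<Rightarrow> ('x \<Rightarrow> bool) \<Rightarrow> 'x \<Rightarrow> bool" where
  "minimal_wrt r P X \<longleftrightarrow> P X \<and> \<not> (\<exists>Y. P Y \<and> r Y X \<and> \<not> r X Y)"

text \<open>Graphs with vertices in \<^typ>\<open>nat\<close> represent all finite graphs up to isomorphism, so nothing
  is lost by taking \<^typ>\<open>nat\<close> as the vertex type when counting isomorphism classes.\<close>

lemma lgraph_iso_nat_copy:
  fixes X :: "('a, 'q) lgraph"
  assumes X: "simple_graph (fst X)"
  shows "\<exists>Y :: (nat, 'q) lgraph. simple_graph (fst Y) \<and> lgraph_iso X Y"
proof -
  define V where "V = verts (fst X)"
  have "finite V"
    using X by (simp add: simple_graph_def V_def)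
  then obtain \<sigma> :: "'a \<Rightarrow> nat" where inj: "inj_on \<sigma> V"
    using finite_imp_inj_to_nat_seg by blast
  let ?Y = "(\<lparr>verts = \<sigma> ` V, edges = (`) \<sigma> ` edges (fst X)\<rparr>, snd X \<circ> inv_into V \<sigma>)"
  have sub: "e \<subseteq> V" "card e = 2" if "e \<in> edges (fst X)" for e
    using X that by (auto simp: simple_graph_def V_def)
  have "simple_graph (fst ?Y)"
    using \<open>finite V\<close> sub inj by (auto simp: simple_graph_def card_image inj_on_subset)
  moreover have "{u, v} \<in> edges (fst X) \<longleftrightarrow> {\<sigma> u, \<sigma> v} \<in> edges (fst ?Y)"
    if "u \<in> V" "v \<in> V" for u v
  proof -
    have "{\<sigma> u, \<sigma> v} = \<sigma> ` {u, v}" by simp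
    moreover have "\<sigma> ` {u, v} = \<sigma> ` e \<longleftrightarrow> {u, v} = e" if "e \<in> edges (fst X)" for e
      using inj_on_image_eq_iff[OF inj, of "{u, v}" e] sub(1)[OF that] \<open>u \<in> V\<close> \<open>v \<in> V\<close> by simp
    ultimately show ?thesis by auto
  qed
  moreover have "snd X v = snd ?Y (\<sigma> v)" if "v \<in> V" for v
    using inj that by simp
  ultimately show ?thesis
    unfolding lgraph_iso_def using inj
    by (intro exI[of _ ?Y] conjI exI[of _ \<sigma>]) (auto simp: V_def bij_betw_def)
qed

lemma lgraph_iso_refl: "lgraph_iso X X"
  unfolding lgraph_iso_def by (rule exI[of _ id]) simp

lemma lgraph_iso_sym:
  assumes "lgraph_iso X Y"
  shows "lgraph_iso Y X"
proof -
  obtain \<sigma> where b: "bij_betw \<sigma> (verts (fst X)) (verts (fst Y))"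
    and e: "\<And>u v. u \<in> verts (fst X) \<Longrightarrow> v \<in> verts (fst X) \<Longrightarrow>
      {u, v} \<in> edges (fst X) \<longleftrightarrow> {\<sigma> u, \<sigma> v} \<in> edges (fst Y)"
    and l: "\<And>v. v \<in> verts (fst X) \<Longrightarrow> snd X v = snd Y (\<sigma> v)"
    using assms unfolding lgraph_iso_def by blast
  let ?\<tau> = "inv_into (verts (fst X)) \<sigma>"
  have "bij_betw ?\<tau> (verts (fst Y)) (verts (fst X))"
    using b by (rule bij_betw_inv_into)
  moreover have "?\<tau> v \<in> verts (fst X)" "\<sigma> (?\<tau> v) = v" if "v \<in> verts (fst Y)" for v
    using b that by (auto simp: bij_betw_def inv_into_into f_inv_into_f)
  ultimately show ?thesis
    unfolding lgraph_iso_def using e l by (intro exI[of _ ?\<tau>]) simp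
qed

lemma lgraph_iso_trans:
  assumes "lgraph_iso X Y" "lgraph_iso Y Z"
  shows "lgraph_iso X Z"
proof -
  obtain \<sigma> where b: "bij_betw \<sigma> (verts (fst X)) (verts (fst Y))"
    and e: "\<And>u v. u \<in> verts (fst X) \<Longrightarrow> v \<in> verts (fst X) \<Longrightarrow>
      {u, v} \<in> edges (fst X) \<longleftrightarrow> {\<sigma> u, \<sigma> v} \<in> edges (fst Y)"
    and l: "\<And>v. v \<in> verts (fst X) \<Longrightarrow> snd X v = snd Y (\<sigma> v)"
    using assms(1) unfolding lgraph_iso_def by blast
  obtain \<tau> where b': "bij_betw \<tau> (verts (fst Y)) (verts (fst Z))"
    and e': "\<And>u v. u \<in> verts (fst Y) \<Longrightarrow> v \<in> verts (fst Y) \<Longrightarrow>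
      {u, v} \<in> edges (fst Y) \<longleftrightarrow> {\<tau> u, \<tau> v} \<in> edges (fst Z)"
    and l': "\<And>v. v \<in> verts (fst Y) \<Longrightarrow> snd Y v = snd Z (\<tau> v)"
    using assms(2) unfolding lgraph_iso_def by blast
  have "\<sigma> v \<in> verts (fst Y)" if "v \<in> verts (fst X)" for v
    using b that by (auto simp: bij_betw_def)
  then show ?thesis
    unfolding lgraph_iso_def using bij_betw_trans[OF b b'] e e' l l'
    by (intro exI[of _ "\<tau> \<circ> \<sigma>"]) simp
qed

lemma equiv_lgraph_iso_rel: "equiv UNIV lgraph_iso_rel"
  unfolding lgraph_iso_rel_def
  by (rule equivI)
    (auto simp: refl_on_def sym_def trans_def
      intro: lgraph_iso_refl lgraph_iso_sym lgraph_iso_trans)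

end

theory Submission
  imports Defs "HOL-Library.Ramsey" "HOL-Library.Disjoint_Sets"
begin

text \<open>
  Deleting a vertex \<open>r\<close> from a graph that is not list-colourable and trying each of the boundedly many
  colours for \<open>r\<close> leaves components with smaller lists that are not list-colourable. Iterating this
  along a path starting at \<open>r\<close>, one sees that a graph without a path on \<open>p + 1\<close> vertices (as a
  subgraph) that is not list-colourable contains a set of at most \<open>N(p)\<close> vertices that is not
  list-colourable; no well-quasi-ordering is needed. Long paths cannot occur in a minimal obstruction:
  by a theorem of Galvin, Rival and Sands, a graph with a long path contains an induced path on \<open>k\<close>
  vertices or a large biclique as a subgraph, and since an obstruction becomes colourable after
  deleting one vertex, its chromatic number is bounded and such a biclique contains an induced one.

  The theorem of Galvin, Rival and Sands is derived by compactness from the case of a one-way infinite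
  path. There, one finds arbitrarily many vertices \<open>x\<^sub>1, \<dots>, x\<^sub>m\<close> together with infinitely many disjoint
  connected sets of bounded size each of which is adjacent to all \<open>x\<^sub>i\<close>. Without a large biclique the
  sets may be taken pairwise anticomplete and the \<open>x\<^sub>i\<close> independent, and Ramsey's theorem for triples
  selects a long sequence of them whose consecutive members can be joined through different sets by
  short paths that avoid the neighbours of all the other members; this gives a long induced path.
\<close>

subsection \<open>Induced paths and bicliques\<close>

text \<open>From here on a graph is a symmetric irreflexive relation \<open>E\<close> with the
  vertex set as a separate argument, because the compactness argument passes to an infinite graph,
  which \<open>simple_graph\<close> excludes.\<close>

definition induced_path :: "'a rel \<Rightarrow> 'a set \<Rightarrow> nat \<Rightarrow> bool" where
  "induced_path E S k \<longleftrightarrow>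
     (\<exists>f. inj_on f {..<k} \<and> f ` {..<k} \<subseteq> S \<and>
        (\<forall>i<k. \<forall>j<k. (f i, f j) \<in> E \<longleftrightarrow> j = Suc i \<or> i = Suc j))"

text \<open>Edges inside \<open>A\<close> and inside \<open>B\<close> are unrestricted, so this is a
  biclique as a subgraph. The cardinalities force \<open>A\<close> and \<open>B\<close> to be finite
  only when \<open>s > 0\<close>.\<close>

definition biclique :: "'a rel \<Rightarrow> 'a set \<Rightarrow> nat \<Rightarrow> bool" where
  "biclique E S s \<longleftrightarrow> (\<exists>A B. A \<subseteq> S \<and> B \<subseteq> S \<and> card A = s \<and> card B = s \<and> A \<inter> B = {} \<and> A \<times> B \<subseteq> E)"

definition connected_set :: "'a rel \<Rightarrow> 'a set \<Rightarrow> bool" where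
  "connected_set E C \<longleftrightarrow> (\<forall>x\<in>C. \<forall>y\<in>C. (x, y) \<in> (Restr E C)\<^sup>*)"

lemma relpow_fun_segment:
  assumes "\<forall>i<r. (f i, f (Suc i)) \<in> R" "i \<le> j" "j \<le> r"
  shows "(f i, f j) \<in> R ^^ (j - i)"
proof -
  have "f (i + 0) = f i \<and> f (i + (j - i)) = f j \<and> (\<forall>l<j - i. (f (i + l), f (i + Suc l)) \<in> R)"
    using assms by auto
  then show ?thesis
    unfolding relpow_fun_conv by (intro exI[of _ "\<lambda>l. f (i + l)"]) simp
qed

text \<open>A shorter connection between two vertices of a shortest walk could be spliced into
  it.\<close>

lemma shortest_walk_geodesic:
  assumes f: "\<forall>i<r. (f i, f (Suc i)) \<in> R" and least: "\<And>r'. (f 0, f r) \<in> R ^^ r' \<Longrightarrow> r \<le> r'"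
    and "i \<le> j" "j \<le> r" "(f i, f j) \<in> R ^^ d"
  shows "j - i \<le> d"
proof -
  have "(f 0, f i) \<in> R ^^ (i - 0)" "(f j, f r) \<in> R ^^ (r - j)"
    using relpow_fun_segment[OF f, of 0 i] relpow_fun_segment[OF f, of j r] assms(3,4) by auto
  with assms(5) have "(f 0, f r) \<in> R ^^ (i + d + (r - j))"
    unfolding relpow_add by auto
  from least[OF this] show ?thesis
    using assms(3,4) by linarith
qed

text \<open>A chord or a repeated vertex would shorten a shortest walk. Hence the first
  \<open>k\<close> vertices of a shortest walk of length at least \<open>k\<close> would form an
  induced path.\<close>

lemma short_walk_if_no_induced_path:
  assumes "sym E" "irrefl E" and no: "\<not> induced_path E S k" and xy: "(x, y) \<in> (Restr E S)\<^sup>*"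
  obtains r where "r < k" "(x, y) \<in> Restr E S ^^ r"
proof -
  let ?R = "Restr E S"
  define r where "r = (LEAST r. (x, y) \<in> ?R ^^ r)"
  have ex: "\<exists>r. (x, y) \<in> ?R ^^ r"
    using xy by (rule rtrancl_imp_relpow)
  then have r: "(x, y) \<in> ?R ^^ r"
    unfolding r_def by (rule LeastI_ex)
  have least: "r \<le> r'" if "(x, y) \<in> ?R ^^ r'" for r'
    unfolding r_def using that by (rule Least_le)
  from r obtain f where f: "f 0 = x" "f r = y" "\<forall>i<r. (f i, f (Suc i)) \<in> ?R"
    unfolding relpow_fun_conv by blast
  have geo: "j - i \<le> d" if "i \<le> j" "j \<le> r" "(f i, f j) \<in> ?R ^^ d" for i j d
    using f(3) least that unfolding f(1,2)[symmetric] by (rule shortest_walk_geodesic)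
  have "r < k"
  proof (rule ccontr)
    assume "\<not> r < k"
    then have kr: "k \<le> r" by simp
    have inS: "f i \<in> S" if "i < k" for i
      using f(3) that kr by auto
    have adj: "(f i, f j) \<in> E \<longleftrightarrow> j = Suc i" if "i < j" "j < k" for i j
    proof
      assume "(f i, f j) \<in> E"
      then have "(f i, f j) \<in> ?R ^^ 1" using inS that by auto
      from geo[OF _ _ this] show "j = Suc i" using that kr by auto
    next
      assume "j = Suc i" then show "(f i, f j) \<in> E" using f(3) that kr by auto
    qed
    have ne: "f i \<noteq> f j" if "i < j" "j < k" for i j
      using geo[of i j 0] that kr by auto
    have "inj_on f {..<k}"
      by (rule linorder_inj_onI) (use ne in auto)
    moreover have "(f i, f j) \<in> E \<longleftrightarrow> j = Suc i \<or> i = Suc j" if "i < k" "j < k" for i j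
      using adj[of i j] adj[of j i] that \<open>sym E\<close> \<open>irrefl E\<close>
      by (cases i j rule: linorder_cases) (auto simp: sym_def irrefl_def)
    ultimately have "induced_path E S k"
      unfolding induced_path_def using inS by (intro exI[of _ f]) auto
    with no show False by simp
  qed
  with r that show thesis by blast
qed

lemma sym_Restr: "sym E \<Longrightarrow> sym (Restr E S)"
  by (auto simp: sym_def)

lemma connected_setI_hub:
  assumes "sym E" "\<And>z. z \<in> C \<Longrightarrow> (z, h) \<in> (Restr E C)\<^sup>*"
  shows "connected_set E C"
  unfolding connected_set_def
proof (intro ballI)
  fix x y assume "x \<in> C" "y \<in> C"
  moreover have "(h, y) \<in> (Restr E C)\<^sup>*"
    using symD[OF sym_rtrancl[OF sym_Restr[OF \<open>sym E\<close>]]] assms(2)[OF \<open>y \<in> C\<close>] by blast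
  ultimately show "(x, y) \<in> (Restr E C)\<^sup>*"
    using assms(2) by (meson rtrancl_trans)
qed

text \<open>Ramsey for pairs: in an infinite homogeneous set of related pairs a single
  \<open>i\<close> would be related to infinitely many elements, against \<open>fin\<close>.\<close>

lemma infinite_independent_subset:
  assumes "infinite J" and sym: "\<And>i j. P i j \<Longrightarrow> P j i"
    and fin: "\<And>i. i \<in> J \<Longrightarrow> finite {j \<in> J. P i j}"
  obtains Y where "Y \<subseteq> J" "infinite Y" "\<And>i j. i \<in> Y \<Longrightarrow> j \<in> Y \<Longrightarrow> i \<noteq> j \<Longrightarrow> \<not> P i j"
proof -
  define f :: "'a set \<Rightarrow> nat" where "f e = (if \<exists>i\<in>e. \<exists>j\<in>e. i \<noteq> j \<and> P i j then 1 else 0)" for e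
  have "f e < 2" for e
    unfolding f_def by (rule if_split[THEN iffD2]) simp
  then have "\<forall>x\<in>J. \<forall>y\<in>J. x \<noteq> y \<longrightarrow> f {x, y} < 2"
    by blast
  from Ramsey2[OF \<open>infinite J\<close> this] obtain Y t
    where "Y \<subseteq> J \<and> infinite Y \<and> t < 2 \<and> (\<forall>x\<in>Y. \<forall>y\<in>Y. x \<noteq> y \<longrightarrow> f {x, y} = t)"
    by (elim exE)
  then have Y: "Y \<subseteq> J" "infinite Y"
    and t: "\<And>x y. x \<in> Y \<Longrightarrow> y \<in> Y \<Longrightarrow> x \<noteq> y \<Longrightarrow> f {x, y} = t" by auto
  have f_iff: "f {i, j} = 1 \<longleftrightarrow> P i j" if "i \<noteq> j" for i j
  proof -
    have "(\<exists>a\<in>{i, j}. \<exists>b\<in>{i, j}. a \<noteq> b \<and> P a b) \<longleftrightarrow> P i j"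
      using that sym by blast
    then show ?thesis
      unfolding f_def by simp
  qed
  obtain i where i: "i \<in> Y"
    using Y(2) by (metis finite.emptyI ex_in_conv)
  have "t \<noteq> 1"
  proof
    assume "t = 1"
    then have "Y - {i} \<subseteq> {j \<in> J. P i j}"
      using Y(1) t[OF i] f_iff[of i] by auto
    then have "finite (Y - {i})"
      using fin[of i] Y(1) i by (blast intro: finite_subset)
    with Y(2) show False
      by simp
  qed
  then show thesis
    using that[OF Y] t f_iff by blast
qed

lemma induced_path_mono: "induced_path E S k \<Longrightarrow> S \<subseteq> T \<Longrightarrow> induced_path E T k"
  unfolding induced_path_def by (meson order_trans)

text \<open>The uniform bound \<open>b\<close> lets the vertices of every member be indexed by
  \<open>{..<b}\<close>, which \<open>anticomplete_subfamily\<close> turns into finitely many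
  colours. Passing to a subfamily shrinks \<open>J\<close> and leaves \<open>F\<close>
  alone.\<close>

definition dominated_family :: "'a rel \<Rightarrow> 'a set \<Rightarrow> nat set \<Rightarrow> (nat \<Rightarrow> 'a set) \<Rightarrow> nat \<Rightarrow> bool" where
  "dominated_family E X J F b \<longleftrightarrow>
     infinite J \<and> disjoint_family_on F J \<and>
     (\<forall>j\<in>J. finite (F j) \<and> card (F j) \<le> b \<and> connected_set E (F j) \<and> F j \<noteq> {} \<and> F j \<inter> X = {} \<and>
        (\<forall>x\<in>X. \<exists>c\<in>F j. (x, c) \<in> E))"

lemma disjoint_family_finite_meeting:
  assumes "disjoint_family_on F J" "finite Z"
  shows "finite {j \<in> J. F j \<inter> Z \<noteq> {}}"
proof -
  have "finite {j \<in> J. z \<in> F j}" for z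
  proof (cases "\<exists>j\<in>J. z \<in> F j")
    case True
    then obtain j where "j \<in> J" "z \<in> F j" by blast
    then have "{j \<in> J. z \<in> F j} \<subseteq> {j}"
      using assms(1) by (auto simp: disjoint_family_on_def)
    then show ?thesis by (rule finite_subset) simp
  next
    case False
    then have "{j \<in> J. z \<in> F j} = {}" by auto
    then show ?thesis using finite.emptyI by metis
  qed
  moreover have "{j \<in> J. F j \<inter> Z \<noteq> {}} = (\<Union>z\<in>Z. {j \<in> J. z \<in> F j})" by blast
  ultimately show ?thesis using assms(2) by simp
qed

text \<open>Repeating the first element gives sets of different sizes one common index
  range.\<close>

lemma finite_nonempty_enumeration:
  assumes "finite S" "S \<noteq> {}" "card S \<le> b"
  obtains p :: "nat \<Rightarrow> 'a" where "S = p ` {..<b}"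
proof -
  obtain h where h: "bij_betw h {0..<card S} S"
    using ex_bij_betw_nat_finite[OF \<open>finite S\<close>] by blast
  have pos: "card S > 0" using assms(1,2) by (simp add: card_gt_0_iff)
  define p where "p i = (if i < card S then h i else h 0)" for i
  have "p ` {..<b} = h ` {0..<card S}"
    using pos assms(3) by (force simp: p_def image_iff)
  then have "S = p ` {..<b}"
    using h by (simp add: bij_betw_def)
  then show thesis by (rule that)
qed

subsection \<open>Infinite paths\<close>

text \<open>The vertices are numbered along the ray; further edges are arbitrary within the two
  exclusions. The locale is there to be refuted in \<open>ray_inconsistent\<close>.\<close>

locale hamiltonian_ray =
  fixes E :: "nat rel" and k s :: nat
  assumes sym_E: "sym E" and irrefl_E: "irrefl E"
    and step: "\<And>n. (n, Suc n) \<in> E"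
    and no_path: "\<not> induced_path E UNIV k"
    and no_biclique: "\<not> biclique E UNIV s"
begin

text \<open>The ray itself connects every tail, and a tail inherits the absence of induced paths on
  \<open>k\<close> vertices.\<close>

lemma tail_walk:
  assumes "M \<le> x" "M \<le> y"
  obtains r where "r < k" "(x, y) \<in> Restr E {M..} ^^ r"
proof -
  have "(M, x) \<in> (Restr E {M..})\<^sup>*" if "M \<le> x" for x
    using that
  proof (induction x rule: dec_induct)
    case (step n)
    then have "(n, Suc n) \<in> Restr E {M..}"
      using hamiltonian_ray.step[OF hamiltonian_ray_axioms] by auto
    with step.IH show ?case by (rule rtrancl_into_rtrancl)
  qed simp
  then have "(x, M) \<in> (Restr E {M..})\<^sup>*" "(M, y) \<in> (Restr E {M..})\<^sup>*"
    using assms symD[OF sym_rtrancl[OF sym_Restr[OF sym_E]]] by blast+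
  then have "(x, y) \<in> (Restr E {M..})\<^sup>*"
    by (rule rtrancl_trans)
  moreover have "\<not> induced_path E {M..} k"
    using no_path induced_path_mono by blast
  ultimately obtain r where "r < k" "(x, y) \<in> Restr E {M..} ^^ r"
    by - (rule short_walk_if_no_induced_path[OF sym_E irrefl_E])
  then show thesis by (rule that)
qed

text \<open>Among all vertices far out, choose one that has infinitely many members of the family within
  the least possible distance \<open>r\<close>. By minimality every vertex is within distance \<open>r - 1\<close> of only
  finitely many members, so the walks of length \<open>r\<close> leading to the members, without their starting
  point, are point-finite.\<close>

lemma dominated_family_step:
  assumes dom: "dominated_family E X J F b" and "finite X"
  obtains x J' F' where "x \<notin> X" "dominated_family E (insert x X) J' F' (b + k)"
proof -
  \<comment> \<open>All walks below stay in the tail \<open>{M..}\<close> and thereby avoid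
    \<open>X\<close>.\<close>
  obtain M where M: "\<And>x. x \<in> X \<Longrightarrow> x < M"
    using \<open>finite X\<close> by (auto simp: finite_nat_set_iff_bounded)
  let ?R = "Restr E {M..}"
  have J: "infinite J" and disj: "disjoint_family_on F J"
    and F: "\<And>j. j \<in> J \<Longrightarrow> finite (F j)" "\<And>j. j \<in> J \<Longrightarrow> card (F j) \<le> b"
      "\<And>j. j \<in> J \<Longrightarrow> connected_set E (F j)" "\<And>j. j \<in> J \<Longrightarrow> F j \<noteq> {}"
      "\<And>j x. j \<in> J \<Longrightarrow> x \<in> X \<Longrightarrow> \<exists>c\<in>F j. (x, c) \<in> E"
    using dom by (auto simp: dominated_family_def)
  define J0 where "J0 = {j \<in> J. F j \<subseteq> {M..}}"
  have "J - J0 = {j \<in> J. F j \<inter> {..<M} \<noteq> {}}"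
    by (auto simp: J0_def)
  then have "finite (J - J0)"
    using disjoint_family_finite_meeting[OF disj, of "{..<M}"] by simp
  then have inf_J0: "infinite J0"
    using J by (metis Diff_infinite_finite)
  have J0: "j \<in> J" "F j \<subseteq> {M..}" if "j \<in> J0" for j
    using that by (auto simp: J0_def)
  define near where "near r x = {j \<in> J0. \<exists>c\<in>F j. \<exists>r'\<le>r. (x, c) \<in> ?R ^^ r'}" for r x
  define r where "r = (LEAST r. \<exists>x\<ge>M. infinite (near r x))"
  \<comment> \<open>By \<open>tail_walk\<close> distance \<open>k\<close> is always enough, so the
    least \<open>r\<close> exists and is at most \<open>k\<close>.\<close>
  have "near k M = J0"
  proof -
    have "j \<in> near k M" if j: "j \<in> J0" for j
    proof -
      obtain c where c: "c \<in> F j" "M \<le> c"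
        using F(4) J0 j by fastforce
      obtain r where "r < k" "(M, c) \<in> ?R ^^ r"
        by (rule tail_walk[OF order_refl c(2)])
      then show ?thesis
        unfolding near_def using j c(1) less_imp_le by blast
    qed
    then show ?thesis by (auto simp: near_def)
  qed
  then have ex: "\<exists>x\<ge>M. infinite (near k M)"
    using inf_J0 by auto
  then have "\<exists>r. \<exists>x\<ge>M. infinite (near r x)" by blast
  then have "\<exists>x\<ge>M. infinite (near r x)"
    unfolding r_def by (rule LeastI_ex)
  then obtain x where x: "x \<ge> M" "infinite (near r x)" by blast
  have "r \<le> k"
    unfolding r_def using ex by (intro Least_le) auto
  have finite_near: "finite (near r' z)" if "z \<ge> M" "r' < r" for z r'
    using not_less_Least[of r' "\<lambda>r. \<exists>x\<ge>M. infinite (near r x)"] that unfolding r_def by blast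
  \<comment> \<open>At most one member contains \<open>x\<close>, which rules out
    \<open>r = 0\<close>.\<close>
  have "near 0 x \<subseteq> {j \<in> J. F j \<inter> {x} \<noteq> {}}"
    by (auto simp: near_def J0_def)
  then have "finite (near 0 x)"
    using disjoint_family_finite_meeting[OF disj, of "{x}"] finite_subset by blast
  with x have "r > 0"
    by (metis gr0I)
  \<comment> \<open>Only members at distance exactly \<open>r\<close> from \<open>x\<close> are
    kept; minimality of \<open>r\<close> leaves infinitely many. Exactness later gives
    \<open>x \<notin> D j\<close>.\<close>
  define J1 where "J1 = near r x - near (r - 1) x"
  have inf_J1: "infinite J1"
    unfolding J1_def using x finite_near[of x "r - 1"] \<open>r > 0\<close> by simp
  have J1: "j \<in> J0" if "j \<in> J1" for j
    using that by (auto simp: J1_def near_def)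
  have "\<forall>j\<in>J1. \<exists>f. f 0 = x \<and> f r \<in> F j \<and> (\<forall>i<r. (f i, f (Suc i)) \<in> ?R)"
  proof
    fix j assume that: "j \<in> J1"
    then obtain c r' where c: "c \<in> F j" "r' \<le> r" "(x, c) \<in> ?R ^^ r'"
      by (auto simp: J1_def near_def)
    have "\<not> r' \<le> r - 1"
      using that c by (auto simp: J1_def near_def)
    then have "r' = r" using c(2) by simp
    then show "\<exists>f. f 0 = x \<and> f r \<in> F j \<and> (\<forall>i<r. (f i, f (Suc i)) \<in> ?R)"
      using c unfolding relpow_fun_conv by blast
  qed
  from bchoice[OF this] obtain f
    where "\<forall>j\<in>J1. f j 0 = x \<and> f j r \<in> F j \<and> (\<forall>i<r. (f j i, f j (Suc i)) \<in> ?R)"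
    by (elim exE)
  then have f: "\<And>j. j \<in> J1 \<Longrightarrow> f j 0 = x" "\<And>j. j \<in> J1 \<Longrightarrow> f j r \<in> F j"
    "\<And>j i. j \<in> J1 \<Longrightarrow> i < r \<Longrightarrow> (f j i, f j (Suc i)) \<in> ?R"
    by simp_all
  \<comment> \<open>The range starts at 1 because the starting point \<open>f j 0 = x\<close> joins
    \<open>X\<close> and must stay outside the members.\<close>
  define D where "D j = F j \<union> f j ` {1..r}" for j
  have D_tail: "D j \<subseteq> {M..}" if "j \<in> J1" for j
  proof -
    have "f j i \<in> {M..}" if "i \<in> {1..r}" for i
      using f(3)[OF \<open>j \<in> J1\<close>, of "i - 1"] that by auto
    then show ?thesis
      using J0(2) J1 that by (auto simp: D_def)
  qed
  have D_near: "j \<in> near (r - 1) z" if "j \<in> J1" "z \<in> D j" for j z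
  proof (cases "z \<in> F j")
    case True
    moreover have "(z, z) \<in> ?R ^^ 0" by simp
    ultimately show ?thesis
      unfolding near_def using J1[OF that(1)] by blast
  next
    case False
    then obtain i where i: "i \<in> {1..r}" "z = f j i"
      using \<open>z \<in> D j\<close> unfolding D_def by blast
    then have "(z, f j r) \<in> ?R ^^ (r - i)"
      using relpow_fun_segment[of r "f j" ?R i r] f(3)[OF that(1)] by auto
    moreover have "r - i \<le> r - 1" using i by auto
    ultimately show ?thesis
      unfolding near_def using J1[OF that(1)] f(2)[OF that(1)] by blast
  qed
  have fin_D: "finite (D j)" if "j \<in> J1" for j
    using F(1) J0(1) J1 that by (auto simp: D_def)
  have point_finite: "finite {j \<in> J1. z \<in> D j}" for z
  proof (cases "z \<ge> M")
    case True
    have "{j \<in> J1. z \<in> D j} \<subseteq> near (r - 1) z"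
      using D_near by blast
    then show ?thesis
      using finite_near[OF True, of "r - 1"] \<open>r > 0\<close> finite_subset by auto
  next
    case False
    then have "{j \<in> J1. z \<in> D j} = {}"
      using D_tail by auto
    then show ?thesis using finite.emptyI by metis
  qed
  have fin_meet: "finite {j \<in> J1. D i \<inter> D j \<noteq> {}}" if "i \<in> J1" for i
  proof -
    have "{j \<in> J1. D i \<inter> D j \<noteq> {}} = (\<Union>z\<in>D i. {j \<in> J1. z \<in> D j})" by blast
    then show ?thesis
      using fin_D[OF that] point_finite by simp
  qed
  obtain Y where Y: "Y \<subseteq> J1" "infinite Y"
    and Y_disj: "\<And>i j. i \<in> Y \<Longrightarrow> j \<in> Y \<Longrightarrow> i \<noteq> j \<Longrightarrow> \<not> D i \<inter> D j \<noteq> {}"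
    by (rule infinite_independent_subset[OF inf_J1, of "\<lambda>i j. D i \<inter> D j \<noteq> {}"])
      (auto simp: Int_commute fin_meet)
  have "dominated_family E (insert x X) Y D (b + k)"
    unfolding dominated_family_def
  proof (intro conjI ballI)
    show "infinite Y" by fact
    show "disjoint_family_on D Y"
      using Y_disj by (auto simp: disjoint_family_on_def)
    fix j assume "j \<in> Y"
    then have j: "j \<in> J1" "j \<in> J" using Y(1) J1 J0(1) by auto
    show "finite (D j)" using fin_D j by blast
    have "card (f j ` {1..r}) \<le> r"
      using card_image_le[of "{1..r}" "f j"] by simp
    then show "card (D j) \<le> b + k"
      using card_Un_le[of "F j" "f j ` {1..r}"] F(2)[OF j(2)] \<open>r \<le> k\<close> by (simp add: D_def)
    show "D j \<noteq> {}" using F(4) j by (simp add: D_def)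
    have "x \<notin> D j"
      using D_near[OF j(1), of x] j(1) by (auto simp: J1_def)
    then show "D j \<inter> insert x X = {}"
      using D_tail[OF j(1)] M by fastforce
    show "\<exists>c\<in>D j. (u, c) \<in> E" if "u \<in> insert x X" for u
    proof (cases "u \<in> X")
      case True
      then show ?thesis using F(5)[OF j(2)] by (auto simp: D_def)
    next
      case False
      then have "(u, f j 1) \<in> E"
        using that f(1)[OF j(1)] f(3)[OF j(1), of 0] \<open>r > 0\<close> by auto
      moreover have "f j 1 \<in> D j" using \<open>r > 0\<close> by (auto simp: D_def)
      ultimately show ?thesis by blast
    qed
    show "connected_set E (D j)"
    proof (rule connected_setI_hub[OF sym_E])
      fix z assume "z \<in> D j"
      show "(z, f j r) \<in> (Restr E (D j))\<^sup>*"
      proof (cases "z \<in> F j")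
        case True
        then have "(z, f j r) \<in> (Restr E (F j))\<^sup>*"
          using F(3)[OF j(2)] f(2)[OF j(1)] by (auto simp: connected_set_def)
        moreover have "Restr E (F j) \<subseteq> Restr E (D j)" by (auto simp: D_def)
        ultimately show ?thesis using rtrancl_mono by blast
      next
        case False
        then obtain i where i: "i \<in> {1..r}" "z = f j i"
          using \<open>z \<in> D j\<close> unfolding D_def by blast
        \<comment> \<open>The walk shifted by one omits \<open>x\<close> and therefore runs inside
          \<open>D j\<close>.\<close>
        define g where "g l = f j (l + 1)" for l
        have "\<forall>l<r - 1. (g l, g (Suc l)) \<in> Restr E (D j)"
          using f(3)[OF j(1)] by (auto simp: g_def D_def)
        from relpow_fun_segment[OF this, of "i - 1" "r - 1"]
        have "(z, f j r) \<in> Restr E (D j) ^^ (r - 1 - (i - 1))"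
          using i by (auto simp: g_def)
        then show ?thesis by (rule relpow_imp_rtrancl)
      qed
    qed
  qed
  moreover have "x \<notin> X" using x M by fastforce
  ultimately show thesis using that by blast
qed

text \<open>Iterates \<open>dominated_family_step\<close>, starting from the empty \<open>X\<close>
  and the singletons as members.\<close>

lemma dominated_family_exists: "\<exists>X J F b. finite X \<and> card X = m \<and> dominated_family E X J F b"
proof (induction m)
  case 0
  have "dominated_family E {} UNIV (\<lambda>j. {j}) 1"
    by (auto simp: dominated_family_def disjoint_family_on_def connected_set_def)
  then show ?case
    by (intro exI conjI) auto
next
  case (Suc m)
  from Suc.IH obtain X J F b where X: "finite X" "card X = m" "dominated_family E X J F b"
    by (elim exE conjE)
  obtain x J' F' where "x \<notin> X" "dominated_family E (insert x X) J' F' (b + k)"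
    by (rule dominated_family_step[OF X(3,1)])
  moreover have "finite (insert x X)" "card (insert x X) = Suc m"
    using X \<open>x \<notin> X\<close> by simp_all
  ultimately show ?case by (intro exI conjI)
qed

section \<open>Finiteness and anticompleteness from the absence of bicliques\<close>

lemma finite_common_neighbours:
  assumes "card A = s"
  shows "finite {v. \<forall>a\<in>A. (a, v) \<in> E}"
proof (rule ccontr)
  assume "infinite {v. \<forall>a\<in>A. (a, v) \<in> E}"
  then obtain B where B: "card B = s" "B \<subseteq> {v. \<forall>a\<in>A. (a, v) \<in> E}"
    using infinite_arbitrarily_large by blast
  then have "A \<times> B \<subseteq> E" by auto
  moreover from this have "A \<inter> B = {}"
    using irrefl_E by (auto simp: irrefl_def)
  ultimately have "biclique E UNIV s"
    using assms B(1) by (auto simp: biclique_def)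
  with no_biclique show False by simp
qed

text \<open>Such a vertex is a common neighbour of one of the finitely many subsets of
  \<open>X\<close> of size \<open>s\<close>, and each of these has only finitely many common
  neighbours.\<close>

lemma finite_many_neighbours:
  assumes "finite X"
  shows "finite {v. s \<le> card {x \<in> X. (x, v) \<in> E}}"
proof -
  have "{v. s \<le> card {x \<in> X. (x, v) \<in> E}} \<subseteq> (\<Union>A\<in>{A \<in> Pow X. card A = s}. {v. \<forall>a\<in>A. (a, v) \<in> E})"
  proof
    fix v assume "v \<in> {v. s \<le> card {x \<in> X. (x, v) \<in> E}}"
    then obtain A where "A \<subseteq> {x \<in> X. (x, v) \<in> E}" "card A = s"
      using obtain_subset_with_card_n[of s "{x \<in> X. (x, v) \<in> E}"] by auto
    then show "v \<in> (\<Union>A\<in>{A \<in> Pow X. card A = s}. {v. \<forall>a\<in>A. (a, v) \<in> E})"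
      by blast
  qed
  moreover have "finite (\<Union>A\<in>{A \<in> Pow X. card A = s}. {v. \<forall>a\<in>A. (a, v) \<in> E})"
    using assms finite_common_neighbours by auto
  ultimately show ?thesis by (rule finite_subset)
qed

text \<open>Ramsey for pairs, coloured by the positions of an edge between the two members. If some
  edge position recurs for all pairs of an infinite set, \<open>s\<close> early members and
  \<open>s\<close> later ones contain a biclique.\<close>

lemma anticomplete_subfamily:
  assumes dom: "dominated_family E X J F b"
  obtains J' where "J' \<subseteq> J" "infinite J'"
    "\<And>i j. i \<in> J' \<Longrightarrow> j \<in> J' \<Longrightarrow> i \<noteq> j \<Longrightarrow> F i \<times> F j \<inter> E = {}"
proof -
  have J: "infinite J" and disj: "disjoint_family_on F J"
    and F: "\<And>j. j \<in> J \<Longrightarrow> finite (F j)" "\<And>j. j \<in> J \<Longrightarrow> card (F j) \<le> b" "\<And>j. j \<in> J \<Longrightarrow> F j \<noteq> {}"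
    using dom by (auto simp: dominated_family_def)
  have "\<forall>j\<in>J. \<exists>p. F j = p ` {..<b}"
  proof
    fix j assume "j \<in> J"
    then obtain p where "F j = p ` {..<b}"
      by (metis finite_nonempty_enumeration F)
    then show "\<exists>p. F j = p ` {..<b}" by blast
  qed
  from bchoice[OF this] obtain p where p: "\<forall>j\<in>J. F j = p j ` {..<b}"
    by (elim exE)
  \<comment> \<open>A number \<open>c < b * b\<close> encodes two positions, \<open>c div b\<close>
    in the member of smaller index and \<open>c mod b\<close> in the other. In \<open>col\<close>
    the value \<open>b * b\<close> stands for the absence of edges.\<close>
  define P where "P e c \<longleftrightarrow> c < b * b \<and> (p (Min e) (c div b), p (Max e) (c mod b)) \<in> E" for e c
  define col where "col e = (if \<exists>c. P e c then SOME c. P e c else b * b)" for e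
  have P_col: "P e (col e)" if "P e c" for e c
    unfolding col_def using someI[of "P e", OF that] that by auto
  have "col e < Suc (b * b)" for e
  proof (cases "\<exists>c. P e c")
    case True
    then show ?thesis using P_col P_def less_SucI by metis
  next
    case False
    then show ?thesis by (simp add: col_def)
  qed
  then have "\<forall>x\<in>J. \<forall>y\<in>J. x \<noteq> y \<longrightarrow> col {x, y} < Suc (b * b)" by blast
  from Ramsey2[OF J this] obtain Y c where "Y \<subseteq> J \<and> infinite Y \<and> c < Suc (b * b)
      \<and> (\<forall>x\<in>Y. \<forall>y\<in>Y. x \<noteq> y \<longrightarrow> col {x, y} = c)"
    by (elim exE)
  then have Y: "Y \<subseteq> J" "infinite Y"
    and c: "\<And>x y. x \<in> Y \<Longrightarrow> y \<in> Y \<Longrightarrow> x \<noteq> y \<Longrightarrow> col {x, y} = c" by auto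
  have Min_Max: "Min {i, j} = i" "Max {i, j} = j" if "i < j" for i j :: nat
    using that by auto
  have anti: "F i \<times> F j \<inter> E = {}" if ij: "i \<in> Y" "j \<in> Y" "i < j" for i j
  proof (rule ccontr)
    assume adjacent: "F i \<times> F j \<inter> E \<noteq> {}"
    have "F i = p i ` {..<b}" "F j = p j ` {..<b}"
      using p Y(1) ij by auto
    with adjacent obtain a a' where a: "a < b" "a' < b" "(p i a, p j a') \<in> E"
      by auto
    have "a * b + a' < Suc a * b" using a by simp
    also have "\<dots> \<le> b * b" using a by (intro mult_le_mono1) simp
    finally have "a * b + a' < b * b" .
    then have "P {i, j} (a * b + a')"
      using a ij by (simp add: P_def Min_Max)
    then have "P {i, j} c"
      using P_col c ij by force
    then have "c < b * b" by (simp add: P_def)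
    have edge: "(p u (c div b), p v (c mod b)) \<in> E" if "u \<in> Y" "v \<in> Y" "u < v" for u v
    proof -
      have "col {u, v} = c" using c that by auto
      moreover from this have "\<exists>c'. P {u, v} c'"
        using \<open>c < b * b\<close> by (auto simp: col_def split: if_splits)
      ultimately have "P {u, v} c" using P_col by metis
      then show ?thesis using that by (simp add: P_def Min_Max)
    qed
    obtain I where I: "finite I" "card I = s" "I \<subseteq> Y"
      using infinite_arbitrarily_large[OF Y(2)] by blast
    obtain M where M: "\<And>u. u \<in> I \<Longrightarrow> u < M"
      using \<open>finite I\<close> by (auto simp: finite_nat_set_iff_bounded)
    \<comment> \<open>Taking \<open>K\<close> beyond all of \<open>I\<close> orients every pair the
      same way, so that \<open>edge\<close> applies to each of them.\<close>
    have "infinite (Y - {..<M})" using Y(2) by simp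
    then obtain K where K: "finite K" "card K = s" "K \<subseteq> Y - {..<M}"
      using infinite_arbitrarily_large by blast
    have "b > 0" using a by simp
    have inF: "p u d \<in> F u" if "u \<in> Y" "d < b" for u d
      using p Y(1) that by auto
    have inj: "inj_on (\<lambda>u. p u d) Y" if "d < b" for d
    proof (rule inj_onI)
      fix u v assume "u \<in> Y" "v \<in> Y" "p u d = p v d"
      then show "u = v"
        using inF[of u d] inF[of v d] that disj Y(1) by (auto simp: disjoint_family_on_def)
    qed
    define A B where "A = (\<lambda>u. p u (c div b)) ` I" and "B = (\<lambda>u. p u (c mod b)) ` K"
    have "c div b < b" "c mod b < b"
      using \<open>c < b * b\<close> \<open>b > 0\<close> by (simp_all add: less_mult_imp_div_less)
    then have "inj_on (\<lambda>u. p u (c div b)) I" "inj_on (\<lambda>u. p u (c mod b)) K"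
      using I(3) K(3) by (auto intro: inj_on_subset[OF inj])
    then have "card A = s" "card B = s"
      unfolding A_def B_def using I(2) K(2) by (simp_all add: card_image)
    moreover have "A \<times> B \<subseteq> E"
      using I(3) K(3) M by (force simp: A_def B_def intro!: edge)
    moreover from this have "A \<inter> B = {}"
      using irrefl_E by (auto simp: irrefl_def)
    ultimately have "biclique E UNIV s"
      by (auto simp: biclique_def)
    with no_biclique show False by simp
  qed
  have "F i \<times> F j \<inter> E = {}" if "i \<in> Y" "j \<in> Y" "i \<noteq> j" for i j
  proof (cases "i < j")
    case False
    then have "F j \<times> F i \<inter> E = {}" using anti that by simp
    then show ?thesis using sym_E by (auto simp: sym_def)
  qed (use anti that in simp)
  with Y show thesis using that by simp
qed

text \<open>Keeps only the inner vertices of a short walk through \<open>C\<close>. The bound on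
  \<open>card Q\<close> must be independent of the size of \<open>C\<close>: in
  \<open>ray_inconsistent\<close> the number \<open>N\<close> is computed from \<open>k\<close> and
  \<open>s\<close> before \<open>b\<close> is known.\<close>

lemma short_connection:
  assumes "connected_set E C" "C \<noteq> {}" "\<exists>c\<in>C. (x, c) \<in> E" "\<exists>c\<in>C. (y, c) \<in> E"
  obtains Q where "Q \<subseteq> C" "finite Q" "card Q \<le> Suc k" "(x, y) \<in> (Restr E ({x, y} \<union> Q))\<^sup>*"
proof -
  let ?R = "Restr E ({x, y} \<union> C)"
  obtain c d where c: "c \<in> C" "(x, c) \<in> E" and d: "d \<in> C" "(y, d) \<in> E"
    using assms(3,4) by blast
  have "(c, d) \<in> (Restr E C)\<^sup>*"
    using assms(1) c d by (auto simp: connected_set_def)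
  moreover have "Restr E C \<subseteq> ?R" by blast
  ultimately have "(c, d) \<in> ?R\<^sup>*" using rtrancl_mono by blast
  moreover have "(x, c) \<in> ?R" "(d, y) \<in> ?R"
    using c d sym_E by (auto simp: sym_def)
  ultimately have "(x, y) \<in> ?R\<^sup>*"
    by (meson converse_rtrancl_into_rtrancl rtrancl_into_rtrancl)
  moreover have "\<not> induced_path E ({x, y} \<union> C) k"
    using no_path induced_path_mono by blast
  ultimately obtain r where r: "r < k" "(x, y) \<in> ?R ^^ r"
    by - (rule short_walk_if_no_induced_path[OF sym_E irrefl_E])
  then obtain f where f: "f 0 = x" "f r = y" "\<forall>i<r. (f i, f (Suc i)) \<in> ?R"
    unfolding relpow_fun_conv by blast
  have in_C: "f i \<in> {x, y} \<union> C" if "i \<le> r" for i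
  proof (cases "i = r")
    case False
    then have "(f i, f (Suc i)) \<in> ?R" using f(3) that by simp
    then show ?thesis by blast
  qed (use f in simp)
  define Q where "Q = f ` {..r} - {x, y}"
  have "card Q \<le> card (f ` {..r})"
    unfolding Q_def by (intro card_mono) auto
  also have "\<dots> \<le> Suc r"
    using card_image_le[of "{..r}" f] by simp
  finally have "card Q \<le> Suc k" using r(1) by simp
  moreover have "Q \<subseteq> C" using in_C by (auto simp: Q_def)
  moreover have "finite Q" by (simp add: Q_def)
  moreover have "\<forall>i<r. (f i, f (Suc i)) \<in> Restr E ({x, y} \<union> Q)"
    using f(3) by (auto simp: Q_def)
  then have "(x, y) \<in> Restr E ({x, y} \<union> Q) ^^ r"
    unfolding relpow_fun_conv using f(1,2) by blast
  then have "(x, y) \<in> (Restr E ({x, y} \<union> Q))\<^sup>*"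
    by (rule relpow_imp_rtrancl)
  ultimately show thesis using that by simp
qed

text \<open>The five colours of a triple \<open>a < b < c\<close> record which of the three vertices is adjacent to the
  path joining the other two, or else whether \<open>a\<close> and \<open>b\<close> are adjacent. Each path has few neighbours
  among the \<open>x\<^sub>i\<close>, so a large homogeneous set can only have the last colour. In the union of
  the paths joining its consecutive members every edge changes the \<open>level\<close> by at most one, hence
  the distance between the two ends is at least \<open>k\<close>.\<close>

lemma ray_inconsistent: False
proof -
  \<comment> \<open>Bounds the number of indices \<open>c\<close> for which \<open>x c\<close> is
    adjacent to a given joining path: at most \<open>Suc k\<close> vertices with at most
    \<open>s\<close> such indices each.\<close>
  define q where "q = Suc k * s"
  \<comment> \<open>The homogeneous set needs more than \<open>q\<close> members besides two fixed
    ones, \<open>2 * s\<close> members before its last one, and \<open>k + 1\<close> members before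
    its last one.\<close>
  define n where "n = q + 2 * s + k + 4"
  have n: "q + 4 \<le> n" "2 * s + 4 \<le> n" "k + 4 \<le> n"
    by (simp_all add: n_def)
  obtain N :: nat where N: "partn_lst {..<N} [n, n, n, n, n] 3"
    using ramsey_full[of "[n, n, n, n, n]" 3] by (elim exE)
  obtain X J F b where X: "finite X" "card X = N" and dom: "dominated_family E X J F b"
    using dominated_family_exists[of N] by (elim exE conjE)
  obtain J1 where J1: "J1 \<subseteq> J" "infinite J1"
    and anti: "\<And>i j. i \<in> J1 \<Longrightarrow> j \<in> J1 \<Longrightarrow> i \<noteq> j \<Longrightarrow> F i \<times> F j \<inter> E = {}"
    using anticomplete_subfamily[OF dom] by metis
  have disj: "disjoint_family_on F J"
    and F: "\<And>j. j \<in> J \<Longrightarrow> connected_set E (F j)" "\<And>j. j \<in> J \<Longrightarrow> F j \<noteq> {}"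
      "\<And>j. j \<in> J \<Longrightarrow> F j \<inter> X = {}" "\<And>j x. j \<in> J \<Longrightarrow> x \<in> X \<Longrightarrow> \<exists>c\<in>F j. (x, c) \<in> E"
    using dom by (auto simp: dominated_family_def)
  \<comment> \<open>Vertices with many neighbours in \<open>X\<close>; they are finitely many, so
    the members meeting them can be discarded.\<close>
  define Z where "Z = {v. s \<le> card {x \<in> X. (x, v) \<in> E}}"
  have "finite Z"
    unfolding Z_def by (rule finite_many_neighbours[OF X(1)])
  define J2 where "J2 = J1 - {j \<in> J. F j \<inter> Z \<noteq> {}}"
  have "infinite J2"
    unfolding J2_def using J1(2) disjoint_family_finite_meeting[OF disj \<open>finite Z\<close>] by simp
  from infinite_countable_subset[OF this] obtain h :: "nat \<Rightarrow> nat"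
    where h: "inj h" "range h \<subseteq> J2"
    by (elim exE conjE)
  \<comment> \<open>Every pair of indices receives a member of its own through the injective coding,
    so paths for different pairs are anticomplete.\<close>
  define G where "G a b = F (h (prod_encode (a, b)))" for a b
  have hJ: "h m \<in> J1" "h m \<in> J" "F (h m) \<inter> Z = {}" for m
    using h(2) J1(1) by (auto simp: J2_def)
  have G: "connected_set E (G a b)" "G a b \<noteq> {}" "G a b \<inter> X = {}"
      "x \<in> X \<Longrightarrow> \<exists>c\<in>G a b. (x, c) \<in> E" "G a b \<inter> Z = {}" for a b x
    unfolding G_def by (simp_all add: F[OF hJ(2)] hJ(3))
  have G_anti: "(u, v) \<notin> E" if "u \<in> G a b" "v \<in> G a' b'" "(a, b) \<noteq> (a', b')" for u v a b a' b'
  proof -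
    have "h (prod_encode (a, b)) \<noteq> h (prod_encode (a', b'))"
      using h(1) that(3) by (simp add: inj_eq)
    from anti[OF hJ(1) hJ(1) this] show ?thesis
      using that(1,2) unfolding G_def by blast
  qed
  obtain x where x: "bij_betw x {0..<N} X"
    using ex_bij_betw_nat_finite[OF X(1)] X(2) by auto
  have xX: "x a \<in> X" if "a < N" for a
    using x that by (auto simp: bij_betw_def)
  have x_inj: "inj_on x {..<N}"
    using x by (auto simp: bij_betw_def atLeast0LessThan)
  have "\<exists>Q. a < N \<longrightarrow> b < N \<longrightarrow>
      Q \<subseteq> G a b \<and> finite Q \<and> card Q \<le> Suc k \<and> (x a, x b) \<in> (Restr E ({x a, x b} \<union> Q))\<^sup>*" for a b
  proof (cases "a < N \<and> b < N")
    case True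
    obtain Q where "Q \<subseteq> G a b" "finite Q" "card Q \<le> Suc k" "(x a, x b) \<in> (Restr E ({x a, x b} \<union> Q))\<^sup>*"
      by (rule short_connection[of "G a b" "x a" "x b"]) (use G xX True in auto)
    then show ?thesis by (intro exI[of _ Q]) simp
  qed auto
  then obtain Q where Q': "\<forall>a b. a < N \<longrightarrow> b < N \<longrightarrow> Q a b \<subseteq> G a b \<and> finite (Q a b) \<and>
      card (Q a b) \<le> Suc k \<and> (x a, x b) \<in> (Restr E ({x a, x b} \<union> Q a b))\<^sup>*"
    by metis
  then have Q: "Q a b \<subseteq> G a b" "finite (Q a b)" "card (Q a b) \<le> Suc k"
      "(x a, x b) \<in> (Restr E ({x a, x b} \<union> Q a b))\<^sup>*" if "a < N" "b < N" for a b
    using that by blast+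
  define bad where "bad c a b \<longleftrightarrow> (\<exists>v\<in>Q a b. (x c, v) \<in> E)" for c a b
  have few_bad: "card {c \<in> {..<N}. bad c a b} \<le> q" if ab: "a < N" "b < N" for a b
  proof -
    have few: "card {c \<in> {..<N}. (x c, v) \<in> E} \<le> s" if v: "v \<in> Q a b" for v
    proof -
      have "v \<notin> Z" using Q(1)[OF ab] G(5)[of a b] v by blast
      then have "card {u \<in> X. (u, v) \<in> E} < s" by (simp add: Z_def)
      moreover have "card {c \<in> {..<N}. (x c, v) \<in> E} = card (x ` {c \<in> {..<N}. (x c, v) \<in> E})"
        by (rule card_image[symmetric]) (rule inj_on_subset[OF x_inj], auto)
      moreover have "\<dots> \<le> card {u \<in> X. (u, v) \<in> E}"
        by (rule card_mono) (use X(1) xX in auto)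
      ultimately show ?thesis by simp
    qed
    have "{c \<in> {..<N}. bad c a b} = (\<Union>v\<in>Q a b. {c \<in> {..<N}. (x c, v) \<in> E})"
      by (auto simp: bad_def)
    then have "card {c \<in> {..<N}. bad c a b} \<le> (\<Sum>v\<in>Q a b. card {c \<in> {..<N}. (x c, v) \<in> E})"
      using card_UN_le[OF Q(2)[OF ab]] by simp
    also have "\<dots> \<le> (\<Sum>v\<in>Q a b. s)"
      by (rule sum_mono) (rule few)
    also have "\<dots> \<le> q"
      using Q(3)[OF ab] by (simp add: q_def mult_le_mono1 del: mult_Suc)
    finally show ?thesis .
  qed
  define colour :: "nat \<Rightarrow> nat \<Rightarrow> nat \<Rightarrow> nat" where
    "colour a b c = (if bad c a b then 0 else if bad b a c then 1 else if bad a b c then 2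
       else if (x a, x b) \<in> E then 3 else 4)" for a b c
  have colour_cases: "colour a b c = 0 \<Longrightarrow> bad c a b" "colour a b c = 1 \<Longrightarrow> bad b a c"
      "colour a b c = 2 \<Longrightarrow> bad a b c" "colour a b c = 3 \<Longrightarrow> (x a, x b) \<in> E"
      "colour a b c = 4 \<Longrightarrow> \<not> bad c a b \<and> \<not> bad b a c \<and> \<not> bad a b c \<and> (x a, x b) \<notin> E" for a b c
    by (auto simp: colour_def split: if_splits)
  \<comment> \<open>Recovers the sorted triple from the set: minimum, middle element,
    maximum.\<close>
  define f where "f T = colour (Min T) (Max (T - {Max T})) (Max T)" for T
  have f: "f {a, b, c} = colour a b c" if "a < b" "b < c" for a b c
  proof -
    have "Min {a, b, c} = a" "Max {a, b, c} = c" "{a, b, c} - {c} = {a, b}" "Max {a, b} = b"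
      using that by auto
    then show ?thesis by (simp add: f_def)
  qed
  have "f \<in> nsets {..<N} 3 \<rightarrow> {..<5}"
    by (auto simp: f_def colour_def)
  then obtain i H where i: "i < length [n, n, n, n, n]" and H': "H \<in> nsets {..<N} ([n, n, n, n, n] ! i)"
    and H_col: "f ` nsets H 3 \<subseteq> {i}"
    by (rule partn_lstE[OF N]) simp
  have "[n, n, n, n, n] ! i = n"
    using i by (auto simp: less_Suc_eq)
  then have H: "H \<subseteq> {..<N}" "finite H" "card H = n"
    using H' by (auto simp: nsets_def)
  define y where "y l = sorted_list_of_set H ! l" for l
  have y_less: "y l < y l'" if "l < l'" "l' < n" for l l'
    using that H strict_sorted_list_of_set[of H] by (simp add: y_def sorted_wrt_iff_nth_less)
  have y_H: "y l \<in> H" if "l < n" for l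
    using nth_mem[of l "sorted_list_of_set H"] that H by (simp add: y_def)
  have y_N: "y l < N" if "l < n" for l
    using y_H H(1) that by blast
  have y_inj: "inj_on y {..<n}"
    by (rule linorder_inj_onI) (use y_less in \<open>auto simp: less_le\<close>)
  have col: "colour (y l) (y l') (y l'') = i" if "l < l'" "l' < l''" "l'' < n" for l l' l''
  proof -
    have "y l < y l'" "y l' < y l''" "y l \<in> H" "y l' \<in> H" "y l'' \<in> H"
      using y_less y_H that by auto
    then have "f {y l, y l', y l''} = colour (y l) (y l') (y l'')" "{y l, y l', y l''} \<in> nsets H 3"
      using f by (auto simp: nsets_def card_insert_if)
    then show ?thesis using H_col by auto
  qed
  have not_all_bad: False
    if "a < n" "b < n" "L \<subseteq> {..<n}" "card L > q" "\<And>l. l \<in> L \<Longrightarrow> bad (y l) (y a) (y b)" for a b L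
  proof -
    have "y ` L \<subseteq> {c \<in> {..<N}. bad c (y a) (y b)}"
      using that y_N by auto
    then have "card (y ` L) \<le> q"
      using few_bad[OF y_N y_N, OF that(1,2)] card_mono[of "{c \<in> {..<N}. bad c (y a) (y b)}" "y ` L"]
      by simp
    then show False
      using card_image[OF inj_on_subset[OF y_inj that(3)]] that(4) by simp
  qed
  have "i = 4"
  proof (rule ccontr)
    assume "i \<noteq> 4"
    moreover have "i < 5" using i by simp
    ultimately consider "i = 0" | "i = 1" | "i = 2" | "i = 3" by linarith
    then show False
    proof cases
      case 1
      have b: "bad (y l) (y 0) (y 1)" if "l \<in> {2..<n}" for l
        using col[of 0 1 l] 1 that by (intro colour_cases) simp
      show False
        by (rule not_all_bad[of 0 1 "{2..<n}", OF _ _ _ _ b]) (use n in auto)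
    next
      case 2
      have b: "bad (y l) (y 0) (y (n - 1))" if "l \<in> {1..<n - 1}" for l
        using col[of 0 l "n - 1"] 2 that by (intro colour_cases) simp
      show False
        by (rule not_all_bad[of 0 "n - 1" "{1..<n - 1}", OF _ _ _ _ b]) (use n in auto)
    next
      case 3
      have b: "bad (y l) (y (n - 2)) (y (n - 1))" if "l \<in> {0..<n - 2}" for l
        using col[of l "n - 2" "n - 1"] 3 that by (intro colour_cases) simp
      show False
        by (rule not_all_bad[of "n - 2" "n - 1" "{0..<n - 2}", OF _ _ _ _ b]) (use n in auto)
    next
      case 4
      \<comment> \<open>The last member serves only as the third index of the triples. All earlier
        ones form a clique, and \<open>2 * s\<close> of them split into a biclique.\<close>
      have edge: "(x (y l), x (y l')) \<in> E" if "l < l'" "l' < n - 1" for l l'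
        using col[of l l' "n - 1"] 4 that by (intro colour_cases(4)) simp
      have xy_inj: "inj_on (\<lambda>l. x (y l)) {..<n}"
        using comp_inj_on[OF y_inj inj_on_subset[OF x_inj]] y_N by (auto simp: comp_def image_subset_iff)
      define A B where "A = (\<lambda>l. x (y l)) ` {..<s}" and "B = (\<lambda>l. x (y l)) ` {s..<2 * s}"
      have "A \<times> B \<subseteq> E"
        using edge by (auto simp: A_def B_def n_def)
      moreover from this have "A \<inter> B = {}"
        using irrefl_E by (auto simp: irrefl_def)
      moreover have "card A = s" "card B = s"
        unfolding A_def B_def by (subst card_image; (rule inj_on_subset[OF xy_inj])?; auto simp: n_def)+
      ultimately have "biclique E UNIV s"
        by (auto simp: biclique_def)
      with no_biclique show False by simp
    qed
  qed
  have free_triple: "\<not> bad (y l'') (y l) (y l') \<and> \<not> bad (y l') (y l) (y l'') \<and>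
      \<not> bad (y l) (y l') (y l'') \<and> (x (y l), x (y l')) \<notin> E"
    if "l < l'" "l' < l''" "l'' < n" for l l' l''
    using col[OF that] \<open>i = 4\<close> by (intro colour_cases) simp
  have indep: "(x (y l), x (y l')) \<notin> E" if "l \<le> k" "l' \<le> k" for l l'
  proof (cases l l' rule: linorder_cases)
    case less
    then show ?thesis
      using free_triple[of l l' "n - 1"] that n by auto
  next
    case equal
    then show ?thesis using irrefl_E by (simp add: irrefl_def)
  next
    case greater
    then have "(x (y l'), x (y l)) \<notin> E"
      using free_triple[of l' l "n - 1"] that n by auto
    then show ?thesis using sym_E by (auto simp: sym_def)
  qed
  have free: "l = j \<or> l = Suc j" if "bad (y l) (y j) (y (Suc j))" "l \<le> k" "j < k" for l j
  proof (rule ccontr)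
    assume "\<not> (l = j \<or> l = Suc j)"
    then consider "l < j" | "l > Suc j" by linarith
    then show False
    proof cases
      case 1
      then show False
        using free_triple[of l j "Suc j"] that n by auto
    next
      case 2
      then show False
        using free_triple[of j "Suc j" l] that n by auto
    qed
  qed
  define W where "W j = Q (y j) (y (Suc j))" for j
  define S where "S = (\<Union>j<k. {x (y j), x (y (Suc j))} \<union> W j)"
  \<comment> \<open>Both \<open>x (y j)\<close> and the path \<open>W j\<close> leading on to the
    next member get level \<open>j\<close>. A relation suffices, as the goal is only that
    \<open>x (y k)\<close> has no level below \<open>k\<close>.\<close>
  define level where "level u j \<longleftrightarrow> j \<le> k \<and> u = x (y j) \<or> j < k \<and> u \<in> W j" for u j
  have W_G: "W j \<subseteq> G (y j) (y (Suc j))" if "j < k" for j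
    unfolding W_def by (rule Q) (use y_N that in \<open>auto simp: n_def\<close>)
  have conn: "(x (y 0), x (y j)) \<in> (Restr E S)\<^sup>*" if "j \<le> k" for j
    using that
  proof (induction j)
    case (Suc j)
    have "(x (y j), x (y (Suc j))) \<in> (Restr E ({x (y j), x (y (Suc j))} \<union> W j))\<^sup>*"
      unfolding W_def by (rule Q) (use y_N Suc.prems in \<open>auto simp: n_def\<close>)
    moreover have "Restr E ({x (y j), x (y (Suc j))} \<union> W j) \<subseteq> Restr E S"
      using Suc.prems unfolding S_def by fastforce
    ultimately have "(x (y j), x (y (Suc j))) \<in> (Restr E S)\<^sup>*"
      using rtrancl_mono by blast
    with Suc show ?case by (meson Suc_leD rtrancl_trans)
  qed simp
  have level_S: "\<exists>j. level u j" if "u \<in> S" for u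
  proof -
    from that obtain j where j: "j < k" "u \<in> {x (y j), x (y (Suc j))} \<union> W j"
      by (auto simp: S_def)
    then have "level u j \<or> level u (Suc j)" by (auto simp: level_def)
    then show ?thesis by blast
  qed
  have level_step: "j' \<le> Suc j" if "level u j" "level v j'" "(u, v) \<in> E" for u v j j'
  proof -
    have vu: "(v, u) \<in> E" using sym_E that(3) by (auto simp: sym_def)
    from that(1,2) consider "j \<le> k" "u = x (y j)" "j' \<le> k" "v = x (y j')"
      | "j \<le> k" "u = x (y j)" "j' < k" "v \<in> W j'" | "j < k" "u \<in> W j" "j' \<le> k" "v = x (y j')"
      | "j < k" "u \<in> W j" "j' < k" "v \<in> W j'"
      unfolding level_def by blast
    then show ?thesis
    proof cases
      case 1
      then show ?thesis using indep that(3) by blast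
    next
      case 2
      then have "bad (y j) (y j') (y (Suc j'))"
        using that(3) by (auto simp: bad_def W_def)
      then show ?thesis using free 2 by fastforce
    next
      case 3
      then have "bad (y j') (y j) (y (Suc j))"
        using vu by (auto simp: bad_def W_def)
      then show ?thesis using free 3 by fastforce
    next
      case 4
      then have "(y j, y (Suc j)) = (y j', y (Suc j'))"
        using G_anti[of u _ _ v] W_G that(3) by blast
      then have "j = j'"
        using y_inj 4 by (auto simp: inj_on_def n_def)
      then show ?thesis by simp
    qed
  qed
  have reach_level: "\<exists>j\<le>r. level u j" if "(x (y 0), u) \<in> Restr E S ^^ r" for r u
    using that
  proof (induction r arbitrary: u)
    case 0
    then show ?case by (auto simp: level_def)
  next
    case (Suc r)
    then obtain w where w: "(x (y 0), w) \<in> Restr E S ^^ r" "(w, u) \<in> E" "u \<in> S" by auto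
    obtain j where j: "j \<le> r" "level w j" using Suc.IH[OF w(1)] by blast
    obtain j' where j': "level u j'" using level_S[OF w(3)] by blast
    have "j' \<le> Suc r" using level_step[OF j(2) j' w(2)] j(1) by simp
    with j' show ?case by blast
  qed
  have "\<not> induced_path E S k"
    using no_path induced_path_mono by blast
  with conn[OF order_refl] obtain r where r: "r < k" "(x (y 0), x (y k)) \<in> Restr E S ^^ r"
    by - (rule short_walk_if_no_induced_path[OF sym_E irrefl_E])
  \<comment> \<open>A short walk would give \<open>x (y k)\<close> a level below \<open>k\<close>;
    injectivity of \<open>x\<close> and \<open>y\<close> and the disjointness of \<open>G\<close>
    from \<open>X\<close> exclude this.\<close>
  from reach_level[OF r(2)] obtain j where j: "j \<le> r" "level (x (y k)) j" by blast
  show False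
  proof (cases "x (y k) = x (y j)")
    case True
    then have "y k = y j"
      using x_inj y_N[of k] y_N[of j] j r by (auto simp: inj_on_def n_def)
    then show False using y_less[of j k] j r by (simp add: n_def)
  next
    case False
    then have "x (y k) \<in> G (y j) (y (Suc j))"
      using j W_G by (auto simp: level_def)
    moreover have "x (y k) \<in> X" using xX y_N[of k] by (simp add: n_def)
    ultimately show False using G(3) by blast
  qed
qed

end

subsection \<open>Compactness\<close>

text \<open>Sequential compactness of Cantor space: the bits of \<open>f\<close> are fixed one after
  another so that infinitely many sequences agree with all bits fixed so far; \<open>S m\<close>
  collects these sequences.\<close>

lemma bool_sequences_accumulate:
  fixes b :: "nat \<Rightarrow> nat \<Rightarrow> bool"
  shows "\<exists>f. \<forall>m. infinite {n. \<forall>i<m. b n i = f i}"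
proof -
  define S where "S = rec_nat UNIV (\<lambda>m T. if infinite {n \<in> T. b n m} then {n \<in> T. b n m} else {n \<in> T. \<not> b n m})"
  define f where "f m \<longleftrightarrow> infinite {n \<in> S m. b n m}" for m
  have S0: "S 0 = UNIV" and S_Suc: "S (Suc m) = {n \<in> S m. b n m = f m}" for m
    by (auto simp: S_def f_def)
  have "infinite (S m)" for m
  proof (induction m)
    case (Suc m)
    have "S m = {n \<in> S m. b n m} \<union> {n \<in> S m. \<not> b n m}" by blast
    then have "infinite {n \<in> S m. b n m} \<or> infinite {n \<in> S m. \<not> b n m}"
      using Suc by (metis finite_Un)
    then show ?case by (cases "f m") (auto simp: S_Suc f_def)
  qed (simp add: S0)
  moreover have "S m \<subseteq> {n. \<forall>i<m. b n i = f i}" for m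
    by (induction m) (auto simp: S_Suc less_Suc_eq)
  ultimately have "infinite {n. \<forall>i<m. b n i = f i}" for m
    by (meson infinite_super)
  then show ?thesis by blast
qed

lemma biclique_0: "biclique E S 0"
  unfolding biclique_def by (intro exI[of _ "{}"]) simp

text \<open>Counterexamples \<open>D p\<close> of all lengths, read as bit sequences over coded
  pairs, accumulate at a graph \<open>E\<close> on all natural numbers. Each finite part of
  \<open>E\<close> occurs in some \<open>D n\<close> with \<open>n\<close> large, so
  \<open>E\<close> satisfies \<open>hamiltonian_ray\<close>.\<close>

lemma long_path_nat:
  "\<exists>p. \<forall>E :: nat rel. sym E \<longrightarrow> irrefl E \<longrightarrow> (\<forall>i<p. (i, Suc i) \<in> E) \<longrightarrow>
     induced_path E {..p} k \<or> biclique E {..p} s"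
proof (rule ccontr)
  assume "\<not> ?thesis"
  then have "\<forall>p. \<exists>E :: nat rel. sym E \<and> irrefl E \<and> (\<forall>i<p. (i, Suc i) \<in> E) \<and>
      \<not> induced_path E {..p} k \<and> \<not> biclique E {..p} s"
    by auto
  from choice[OF this] obtain D :: "nat \<Rightarrow> nat rel" where
    "\<forall>p. sym (D p) \<and> irrefl (D p) \<and> (\<forall>i<p. (i, Suc i) \<in> D p) \<and>
      \<not> induced_path (D p) {..p} k \<and> \<not> biclique (D p) {..p} s"
    by (elim exE)
  then have D: "sym (D p)" "irrefl (D p)" "i < p \<Longrightarrow> (i, Suc i) \<in> D p"
      "\<not> induced_path (D p) {..p} k" "\<not> biclique (D p) {..p} s" for p i
    by simp_all
  from bool_sequences_accumulate[of "\<lambda>n c. prod_decode c \<in> D n"] obtain f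
    where f: "\<forall>m. infinite {n. \<forall>c<m. (prod_decode c \<in> D n) = f c}"
    by (elim exE)
  define E where "E = {e. f (prod_encode e)}"
  have agree: "\<exists>n\<ge>M. \<forall>i\<le>M. \<forall>j\<le>M. (i, j) \<in> E \<longleftrightarrow> (i, j) \<in> D n" for M
  proof -
    \<comment> \<open>Exceeds the code of every pair up to \<open>M\<close>, so agreement on the
      first \<open>m\<close> bits settles all these pairs.\<close>
    define m where "m = Suc (Max (prod_encode ` ({..M} \<times> {..M})))"
    have code: "prod_encode (i, j) < m" if "i \<le> M" "j \<le> M" for i j
      using that by (auto simp: m_def less_Suc_eq_le intro!: Max_ge)
    from f have "infinite {n. \<forall>c<m. (prod_decode c \<in> D n) = f c}" ..
    then have "\<exists>n\<ge>M. n \<in> {n. \<forall>c<m. (prod_decode c \<in> D n) = f c}"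
      unfolding infinite_nat_iff_unbounded_le ..
    then obtain n where n: "n \<ge> M" "\<forall>c<m. (prod_decode c \<in> D n) = f c"
      by (elim exE conjE CollectE)
    have "(i, j) \<in> E \<longleftrightarrow> (i, j) \<in> D n" if "i \<le> M" "j \<le> M" for i j
      using n(2) code[OF that] by (auto simp: E_def)
    with n(1) show ?thesis by blast
  qed
  have E_sym: "(j, i) \<in> E" if "(i, j) \<in> E" for i j
  proof -
    from agree[of "max i j"] obtain n where
      n: "\<forall>a\<le>max i j. \<forall>b\<le>max i j. (a, b) \<in> E \<longleftrightarrow> (a, b) \<in> D n" by auto
    then have "(i, j) \<in> D n" using that by simp
    then have "(j, i) \<in> D n" using D(1) by (meson symD)
    then show ?thesis using n by simp
  qed
  have E_irrefl: "(i, i) \<notin> E" for i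
  proof -
    from agree[of i] obtain n where "(i, i) \<in> E \<longleftrightarrow> (i, i) \<in> D n" by auto
    then show ?thesis using D(2)[of n] by (simp add: irrefl_def)
  qed
  have E_step: "(i, Suc i) \<in> E" for i
  proof -
    from agree[of "Suc i"] obtain n where "n \<ge> Suc i" "(i, Suc i) \<in> E \<longleftrightarrow> (i, Suc i) \<in> D n" by auto
    then show ?thesis using D(3)[of i n] by simp
  qed
  have no_path: "\<not> induced_path E UNIV k"
  proof
    assume "induced_path E UNIV k"
    then obtain g where g: "inj_on g {..<k}"
        "\<forall>i<k. \<forall>j<k. (g i, g j) \<in> E \<longleftrightarrow> j = Suc i \<or> i = Suc j"
      by (auto simp: induced_path_def)
    \<comment> \<open>The added 0 keeps \<open>Max\<close> meaningful when
      \<open>k = 0\<close>.\<close>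
    define M where "M = Max (g ` {..<k} \<union> {0})"
    have M: "g i \<le> M" if "i < k" for i
      using that by (auto simp: M_def intro!: Max_ge)
    obtain n where n: "n \<ge> M" "\<forall>a\<le>M. \<forall>b\<le>M. (a, b) \<in> E \<longleftrightarrow> (a, b) \<in> D n"
      using agree by blast
    have "g ` {..<k} \<subseteq> {..n}" using M n(1) by fastforce
    moreover have "\<forall>i<k. \<forall>j<k. (g i, g j) \<in> D n \<longleftrightarrow> j = Suc i \<or> i = Suc j"
      using g(2) n(2) M by simp
    ultimately have "induced_path (D n) {..n} k"
      unfolding induced_path_def using g(1) by (intro exI[of _ g] conjI)
    with D(4) show False by blast
  qed
  have no_biclique: "\<not> biclique E UNIV s"
  proof
    assume "biclique E UNIV s"
    then obtain A B where AB: "card A = s" "card B = s" "A \<inter> B = {}" "A \<times> B \<subseteq> E"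
      by (auto simp: biclique_def)
    \<comment> \<open>Positivity is what turns the cardinalities of \<open>A\<close> and
      \<open>B\<close> into finiteness.\<close>
    have "s > 0" using D(5)[of 0] biclique_0 by (cases s) auto
    then have "finite (A \<union> B)" using AB(1,2) card_ge_0_finite by auto
    then obtain M where "\<forall>a\<in>A \<union> B. a \<le> M"
      by (auto simp: finite_nat_set_iff_bounded_le)
    then have M: "a \<le> M" if "a \<in> A \<union> B" for a using that by blast
    obtain n where n: "n \<ge> M" "\<forall>a\<le>M. \<forall>b\<le>M. (a, b) \<in> E \<longleftrightarrow> (a, b) \<in> D n"
      using agree by blast
    have "A \<subseteq> {..n}" "B \<subseteq> {..n}" using M n(1) by fastforce+
    moreover have "A \<times> B \<subseteq> D n"
      using AB(4) n(2) M by auto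
    ultimately have "biclique (D n) {..n} s"
      unfolding biclique_def using AB by (intro exI[of _ A] exI[of _ B] conjI)
    with D(5) show False by blast
  qed
  interpret hamiltonian_ray E k s
    by unfold_locales
      (use E_sym E_irrefl E_step no_path no_biclique in \<open>auto simp: sym_def irrefl_def\<close>)
  show False by (rule ray_inconsistent)
qed

text \<open>Pulls the adjacency back along \<open>q\<close> to the index set and carries the path or
  biclique found there forward again; \<open>p\<close> is chosen before \<open>E\<close> and
  \<open>q\<close>.\<close>

lemma long_path_imp_induced_path_or_biclique:
  obtains p where "\<And>(E :: 'a rel) q. sym E \<Longrightarrow> irrefl E \<Longrightarrow> inj_on q {..p} \<Longrightarrow>
      \<forall>i<p. (q i, q (Suc i)) \<in> E \<Longrightarrow> induced_path E (q ` {..p}) k \<or> biclique E (q ` {..p}) s"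
proof -
  obtain p where p: "\<forall>E :: nat rel. sym E \<longrightarrow> irrefl E \<longrightarrow> (\<forall>i<p. (i, Suc i) \<in> E) \<longrightarrow>
     induced_path E {..p} k \<or> biclique E {..p} s"
    using long_path_nat[of k s] by (elim exE)
  have "induced_path E (q ` {..p}) k \<or> biclique E (q ` {..p}) s"
    if E: "sym E" "irrefl E" and q: "inj_on q {..p}" "\<forall>i<p. (q i, q (Suc i)) \<in> E"
    for E :: "'a rel" and q
  proof -
    define D where "D = {(i, j). (q i, q j) \<in> E}"
    have "sym D" "irrefl D" "\<forall>i<p. (i, Suc i) \<in> D"
      using E q(2) by (auto simp: D_def sym_def irrefl_def)
    with p have "induced_path D {..p} k \<or> biclique D {..p} s" by blast
    then show ?thesis
    proof
      assume "induced_path D {..p} k"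
      then obtain g where g: "inj_on g {..<k}" "g ` {..<k} \<subseteq> {..p}"
          "\<forall>i<k. \<forall>j<k. (g i, g j) \<in> D \<longleftrightarrow> j = Suc i \<or> i = Suc j"
        unfolding induced_path_def by (elim exE conjE)
      have "inj_on (q \<circ> g) {..<k}"
        using g q(1) by (intro comp_inj_on) (auto intro: inj_on_subset)
      moreover have "(q \<circ> g) ` {..<k} \<subseteq> q ` {..p}"
        using g(2) by fastforce
      moreover have "\<forall>i<k. \<forall>j<k. ((q \<circ> g) i, (q \<circ> g) j) \<in> E \<longleftrightarrow> j = Suc i \<or> i = Suc j"
        using g(3) by (simp add: D_def)
      ultimately show ?thesis
        unfolding induced_path_def by (intro disjI1 exI[of _ "q \<circ> g"] conjI)
    next
      assume "biclique D {..p} s"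
      then obtain A B where AB: "A \<subseteq> {..p}" "B \<subseteq> {..p}" "card A = s" "card B = s" "A \<inter> B = {}" "A \<times> B \<subseteq> D"
        unfolding biclique_def by (elim exE conjE)
      have "card (q ` A) = s" "card (q ` B) = s"
        using AB q(1) by (metis card_image inj_on_subset)+
      moreover have "q ` A \<inter> q ` B = {}"
        using inj_on_image_Int[OF q(1) AB(1,2)] AB(5) by simp
      moreover have "q ` A \<times> q ` B \<subseteq> E"
        using AB(6) by (auto simp: D_def)
      ultimately show ?thesis
        unfolding biclique_def using AB(1,2)
        by (intro disjI2 exI[of _ "q ` A"] exI[of _ "q ` B"] conjI) (simp_all add: image_mono)
    qed
  qed
  then show thesis by (rule that)
qed

subsection \<open>Obstructions in graphs without long paths\<close>

text \<open>That colours are vertices of the target is left to the lists \<open>L\<close>, which the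
  induction below replaces by smaller ones.\<close>

definition colourable :: "'a rel \<Rightarrow> 'h rel \<Rightarrow> ('a \<Rightarrow> 'h set) \<Rightarrow> 'a set \<Rightarrow> bool" where
  "colourable E R L S \<longleftrightarrow>
     (\<exists>\<phi>. (\<forall>v\<in>S. \<phi> v \<in> L v) \<and> (\<forall>u\<in>S. \<forall>v\<in>S. (u, v) \<in> E \<longrightarrow> (\<phi> u, \<phi> v) \<in> R))"

definition component :: "'a rel \<Rightarrow> 'a set \<Rightarrow> 'a \<Rightarrow> 'a set" where
  "component E S r = {v. (r, v) \<in> (Restr E S)\<^sup>*}"

text \<open>Here \<open>p\<close> counts edges, whereas \<open>induced_path\<close> counts vertices.
  The fixed first vertex is where an induction step prolongs the path.\<close>

definition path_from :: "'a rel \<Rightarrow> 'a set \<Rightarrow> 'a \<Rightarrow> nat \<Rightarrow> bool" where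
  "path_from E S r p \<longleftrightarrow>
     (\<exists>q. q 0 = r \<and> inj_on q {..p} \<and> q ` {..p} \<subseteq> S \<and> (\<forall>i<p. (q i, q (Suc i)) \<in> E))"

lemma component_refl: "r \<in> component E S r"
  by (simp add: component_def)

lemma component_subset: "r \<in> S \<Longrightarrow> component E S r \<subseteq> S"
  unfolding component_def by (auto elim: rtranclE)

lemma component_eq:
  assumes "sym E" "(u, v) \<in> (Restr E S)\<^sup>*"
  shows "component E S u = component E S v"
proof -
  have "sym (Restr E S)" using assms(1) by (auto simp: sym_def)
  then have "(v, u) \<in> (Restr E S)\<^sup>*"
    using assms(2) by (meson sym_rtrancl symD)
  with assms(2) show ?thesis
    unfolding component_def by (auto intro: rtrancl_trans)
qed

text \<open>A walk from \<open>r\<close> inside \<open>S\<close> never leaves the component. This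
  form supplies the connectedness hypothesis when the component becomes the new vertex set.\<close>

lemma component_connected:
  assumes "v \<in> component E S r"
  shows "(r, v) \<in> (Restr E (component E S r))\<^sup>*"
proof -
  have "(r, v) \<in> (Restr E S)\<^sup>*" using assms by (simp add: component_def)
  then show ?thesis
  proof (induction rule: rtrancl_induct)
    case (step u v)
    then have "(r, v) \<in> (Restr E S)\<^sup>*" by (simp add: rtrancl_into_rtrancl)
    then have "(u, v) \<in> Restr E (component E S r)"
      using step.hyps by (auto simp: component_def)
    with step.IH show ?case by (rule rtrancl_into_rtrancl)
  qed simp
qed

lemma not_colourable_component:
  assumes "sym E" and not: "\<not> colourable E R L S"
  obtains r where "r \<in> S" "\<not> colourable E R L (component E S r)"
proof (rule ccontr)
  assume "\<not> thesis"
  then have all: "colourable E R L (component E S r)" if "r \<in> S" for r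
    using that assms(2) \<open>\<And>r. r \<in> S \<Longrightarrow> \<not> colourable E R L (component E S r) \<Longrightarrow> thesis\<close> by blast
  define P where "P K \<phi> \<longleftrightarrow> (\<forall>v\<in>K. \<phi> v \<in> L v) \<and> (\<forall>u\<in>K. \<forall>v\<in>K. (u, v) \<in> E \<longrightarrow> (\<phi> u, \<phi> v) \<in> R)"
    for K \<phi>
  \<comment> \<open>The choice depends on the component as a set, so all of its vertices use the
    same colouring.\<close>
  define \<Psi> where "\<Psi> K = (SOME \<phi>. P K \<phi>)" for K
  have P: "P (component E S r) (\<Psi> (component E S r))" if "r \<in> S" for r
    using all[OF that] unfolding \<Psi>_def colourable_def P_def[symmetric] by (rule someI_ex)
  define \<phi> where "\<phi> v = \<Psi> (component E S v) v" for v
  have "\<phi> v \<in> L v" if "v \<in> S" for v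
    using P[OF that] component_refl[of v E S] by (simp add: P_def \<phi>_def)
  moreover have "(\<phi> u, \<phi> v) \<in> R" if "u \<in> S" "v \<in> S" "(u, v) \<in> E" for u v
  proof -
    have uv: "(u, v) \<in> (Restr E S)\<^sup>*" using that by blast
    then have "v \<in> component E S u" by (simp add: component_def)
    then have "(\<Psi> (component E S u) u, \<Psi> (component E S u) v) \<in> R"
      using P[OF that(1)] component_refl[of u E S] that(3) by (simp add: P_def)
    then show ?thesis
      using component_eq[OF assms(1) uv] by (simp add: \<phi>_def)
  qed
  ultimately have "colourable E R L S"
    unfolding colourable_def by (intro exI[of _ \<phi>]) simp
  with not show False by simp
qed

text \<open>The vertex \<open>w\<close> is the one right after the last visit of the walk to
  \<open>r\<close>.\<close>

lemma component_of_neighbour: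
  assumes "(r, u) \<in> (Restr E S)\<^sup>*" "u \<noteq> r"
  shows "\<exists>w\<in>S - {r}. (r, w) \<in> E \<and> (w, u) \<in> (Restr E (S - {r}))\<^sup>*"
proof -
  have "u = r \<or> (\<exists>w\<in>S - {r}. (r, w) \<in> E \<and> (w, u) \<in> (Restr E (S - {r}))\<^sup>*)"
    using assms(1)
  proof (induction rule: rtrancl_induct)
    case (step y z)
    then have yz: "(y, z) \<in> E" "y \<in> S" "z \<in> S" by auto
    consider "z = r" | "z \<noteq> r" "y = r" | "z \<noteq> r" "y \<noteq> r" by blast
    then show ?case
    proof cases
      case 2
      then have "z \<in> S - {r}" "(r, z) \<in> E" "(z, z) \<in> (Restr E (S - {r}))\<^sup>*"
        using yz by auto
      then show ?thesis by blast
    next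
      case 3
      then obtain w where w: "w \<in> S - {r}" "(r, w) \<in> E" "(w, y) \<in> (Restr E (S - {r}))\<^sup>*"
        using step.IH by blast
      have "(y, z) \<in> Restr E (S - {r})" using 3 yz by simp
      with w(3) have "(w, z) \<in> (Restr E (S - {r}))\<^sup>*" by (rule rtrancl_into_rtrancl)
      with w show ?thesis by blast
    qed simp
  qed simp
  with assms(2) show ?thesis by blast
qed

lemma path_from_Suc:
  assumes "path_from E K w p" "(r, w) \<in> E" "K \<subseteq> S - {r}" "r \<in> S"
  shows "path_from E S r (Suc p)"
proof -
  from assms(1) obtain q where q: "q 0 = w" "inj_on q {..p}" "q ` {..p} \<subseteq> K"
      "\<forall>i<p. (q i, q (Suc i)) \<in> E"
    unfolding path_from_def by (elim exE conjE)
  define g where "g i = (case i of 0 \<Rightarrow> r | Suc j \<Rightarrow> q j)" for i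
  have g: "g 0 = r" "g (Suc j) = q j" for j by (simp_all add: g_def)
  have img: "g ` {..Suc p} = insert r (q ` {..p})"
    unfolding atMost_Suc_eq_insert_0 by (auto simp: g image_image)
  have "inj_on (\<lambda>j. g (Suc j)) {..p}" using q(2) by (simp add: g)
  then have "inj_on g (Suc ` {..p})"
    by (auto simp: inj_on_def)
  moreover have "g 0 \<notin> g ` (Suc ` {..p})"
    using q(3) assms(3) by (auto simp: g image_image)
  ultimately have "inj_on g {..Suc p}"
    unfolding atMost_Suc_eq_insert_0 by (auto simp: inj_on_insert)
  moreover have "\<forall>i<Suc p. (g i, g (Suc i)) \<in> E"
    using q(1,4) assms(2) by (auto simp: g less_Suc_eq_0_disj)
  ultimately show ?thesis
    unfolding path_from_def using g(1) img q(3) assms(3,4) by (intro exI[of _ g] conjI) auto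
qed

text \<open>One root plus one smaller obstruction for each of at most \<open>h\<close> colours of
  the root. The value at 0 is arbitrary in effect, since a path without edges always exists.\<close>

primrec obstruction_bound :: "nat \<Rightarrow> nat \<Rightarrow> nat" where
  "obstruction_bound h 0 = 0"
| "obstruction_bound h (Suc p) = Suc (h * obstruction_bound h p)"

text \<open>Delete the root. Each colour \<open>c\<close> of the root shrinks the lists of its neighbours and leaves
  some component uncolourable; that component contains a neighbour of the root, from which only
  shorter paths start. The obstructions obtained for the various \<open>c\<close> and the root together form an
  obstruction.\<close>

lemma small_obstruction_if_no_long_path:
  assumes "sym E" "irrefl E" "sym R" "finite W"
    and "r \<in> S" "\<And>v. v \<in> S \<Longrightarrow> (r, v) \<in> (Restr E S)\<^sup>*" "\<And>v. v \<in> S \<Longrightarrow> L v \<subseteq> W"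
    and "\<not> path_from E S r p" "\<not> colourable E R L S"
  shows "\<exists>T\<subseteq>S. finite T \<and> card T \<le> obstruction_bound (card W) p \<and> \<not> colourable E R L T"
  using assms(5-9)
proof (induction p arbitrary: r S L)
  case 0
  have "path_from E S r 0"
    unfolding path_from_def using 0 by (intro exI[of _ "\<lambda>_. r"]) simp
  with 0 show ?case by simp
next
  case (Suc p)
  define M where "M c v = (if (r, v) \<in> E then L v \<inter> {d. (c, d) \<in> R} else L v)" for c v
  have "\<exists>T\<subseteq>S. finite T \<and> card T \<le> obstruction_bound (card W) p \<and> \<not> colourable E R (M c) T"
    if c: "c \<in> L r" for c
  proof -
    have "\<not> colourable E R (M c) (S - {r})"
    proof
      assume "colourable E R (M c) (S - {r})"
      then obtain \<phi> where \<phi>: "\<And>v. v \<in> S - {r} \<Longrightarrow> \<phi> v \<in> M c v"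
          "\<And>u v. u \<in> S - {r} \<Longrightarrow> v \<in> S - {r} \<Longrightarrow> (u, v) \<in> E \<Longrightarrow> (\<phi> u, \<phi> v) \<in> R"
        unfolding colourable_def by blast
      define \<psi> where "\<psi> = \<phi>(r := c)"
      have "\<psi> v \<in> L v" if "v \<in> S" for v
        using \<phi>(1)[of v] that c by (auto simp: \<psi>_def M_def split: if_splits)
      moreover have root: "(c, \<phi> v) \<in> R" if "v \<in> S" "(r, v) \<in> E" for v
      proof -
        have "v \<noteq> r" using that(2) assms(2) by (auto simp: irrefl_def)
        then show ?thesis using \<phi>(1)[of v] that by (simp add: M_def)
      qed
      have "(\<psi> u, \<psi> v) \<in> R" if uv: "u \<in> S" "v \<in> S" "(u, v) \<in> E" for u v
      proof -
        have "u \<noteq> v" using uv(3) assms(2) by (auto simp: irrefl_def)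
        consider "u = r" "v \<noteq> r" | "u \<noteq> r" "v = r" | "u \<noteq> r" "v \<noteq> r" using \<open>u \<noteq> v\<close> by blast
        then show ?thesis
        proof cases
          case 1
          then show ?thesis using root uv by (simp add: \<psi>_def)
        next
          case 2
          then have "(c, \<phi> u) \<in> R" using root uv symD[OF assms(1)] by blast
          then show ?thesis using 2 symD[OF assms(3)] by (simp add: \<psi>_def)
        next
          case 3
          then show ?thesis using \<phi>(2) uv by (simp add: \<psi>_def)
        qed
      qed
      ultimately have "colourable E R L S"
        unfolding colourable_def by (intro exI[of _ \<psi>]) simp
      with Suc.prems(5) show False by simp
    qed
    then obtain u where u: "u \<in> S - {r}" "\<not> colourable E R (M c) (component E (S - {r}) u)"
      by (rule not_colourable_component[OF assms(1)])
    have "\<exists>w\<in>S - {r}. (r, w) \<in> E \<and> (w, u) \<in> (Restr E (S - {r}))\<^sup>*"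
      by (rule component_of_neighbour) (use Suc.prems(2) u in auto)
    then obtain w where w: "w \<in> S - {r}" "(r, w) \<in> E" "(w, u) \<in> (Restr E (S - {r}))\<^sup>*" by blast
    \<comment> \<open>The component is named after \<open>w\<close> so that \<open>r\<close> can be
      put in front of any path starting at the new root.\<close>
    define K where "K = component E (S - {r}) w"
    have K: "\<not> colourable E R (M c) K" "K \<subseteq> S - {r}" "w \<in> K"
      unfolding K_def
      using u(2) component_eq[OF assms(1) w(3)] component_subset[OF w(1), of E] component_refl[of w E]
      by metis+
    have "\<exists>T\<subseteq>K. finite T \<and> card T \<le> obstruction_bound (card W) p \<and> \<not> colourable E R (M c) T"
    proof (rule Suc.IH)
      show "(w, v) \<in> (Restr E K)\<^sup>*" if "v \<in> K" for v
        using that unfolding K_def by (rule component_connected)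
      show "M c v \<subseteq> W" if "v \<in> K" for v
        using Suc.prems(3)[of v] that K(2) by (auto simp: M_def)
      show "\<not> path_from E K w p"
        using path_from_Suc[OF _ w(2) K(2) Suc.prems(1)] Suc.prems(4) by blast
    qed (use K in simp_all)
    with K(2) show ?thesis by (meson Diff_subset order_trans)
  qed
  then have "\<forall>c\<in>L r. \<exists>T. T \<subseteq> S \<and> finite T \<and> card T \<le> obstruction_bound (card W) p \<and> \<not> colourable E R (M c) T"
    by simp
  from bchoice[OF this] obtain T where T: "\<forall>c\<in>L r. T c \<subseteq> S \<and> finite (T c) \<and>
      card (T c) \<le> obstruction_bound (card W) p \<and> \<not> colourable E R (M c) (T c)"
    by (elim exE)
  have Lr: "L r \<subseteq> W" "finite (L r)" "card (L r) \<le> card W"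
    using Suc.prems(1,3) assms(4) by (auto intro: finite_subset card_mono)
  define U where "U = insert r (\<Union>c\<in>L r. T c)"
  have "card (\<Union>c\<in>L r. T c) \<le> (\<Sum>c\<in>L r. card (T c))"
    by (rule card_UN_le[OF Lr(2)])
  also have "\<dots> \<le> (\<Sum>c\<in>L r. obstruction_bound (card W) p)"
    by (rule sum_mono) (use T in blast)
  also have "\<dots> \<le> card W * obstruction_bound (card W) p"
    using Lr(3) by (simp add: mult_le_mono1)
  finally have "card U \<le> obstruction_bound (card W) (Suc p)"
    unfolding U_def
    by (simp add: card_insert_if Lr(2) T)
  moreover have "U \<subseteq> S" "finite U"
    unfolding U_def using T Lr(2) Suc.prems(1) by auto
  moreover have "\<not> colourable E R L U"
  proof
    assume "colourable E R L U"
    then obtain \<phi> where \<phi>: "\<And>v. v \<in> U \<Longrightarrow> \<phi> v \<in> L v"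
        "\<And>u v. u \<in> U \<Longrightarrow> v \<in> U \<Longrightarrow> (u, v) \<in> E \<Longrightarrow> (\<phi> u, \<phi> v) \<in> R"
      unfolding colourable_def by blast
    have r: "r \<in> U" "\<phi> r \<in> L r" using \<phi>(1) by (auto simp: U_def)
    \<comment> \<open>The colour of the root selects the obstruction \<open>T (\<phi> r)\<close>,
      which \<phi> would colour from the lists \<open>M (\<phi> r)\<close>.\<close>
    then have sub: "T (\<phi> r) \<subseteq> U" by (auto simp: U_def)
    have "colourable E R (M (\<phi> r)) (T (\<phi> r))"
      unfolding colourable_def
    proof (intro exI[of _ \<phi>] conjI ballI impI)
      show "\<phi> v \<in> M (\<phi> r) v" if "v \<in> T (\<phi> r)" for v
        using \<phi>(1)[of v] \<phi>(2)[OF r(1), of v] that sub by (auto simp: M_def)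
    qed (use \<phi>(2) sub in blast)
    with T r(2) show False by blast
  qed
  ultimately show ?case by blast
qed

subsection \<open>Minimal obstructions\<close>

definition adjacency :: "'a ugraph \<Rightarrow> 'a rel" where
  "adjacency G = {(u, v). u \<in> verts G \<and> v \<in> verts G \<and> {u, v} \<in> edges G}"

definition induced_subgraph :: "'a ugraph \<Rightarrow> 'a set \<Rightarrow> 'a ugraph" where
  "induced_subgraph G S = \<lparr>verts = S, edges = {e \<in> edges G. e \<subseteq> S}\<rparr>"

lemma sym_adjacency: "sym (adjacency G)"
  by (auto simp: adjacency_def sym_def insert_commute)

lemma irrefl_adjacency: "simple_graph G \<Longrightarrow> irrefl (adjacency G)"
  by (auto simp: adjacency_def irrefl_def simple_graph_def)

text \<open>The range condition moves into the lists, which thereby all lie in the finite set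
  \<open>verts H\<close>, as \<open>small_obstruction_if_no_long_path\<close> requires.\<close>

lemma list_colorable_iff_colourable:
  assumes "S \<subseteq> verts G"
  shows "list_colorable H (induced_subgraph G S, f) \<longleftrightarrow>
    colourable (adjacency G) (adjacency H) (\<lambda>v. f v \<inter> verts H) S"
proof -
  have "(\<phi> ` S \<subseteq> verts H \<and> (\<forall>u\<in>S. \<forall>v\<in>S. {u, v} \<in> edges G \<longrightarrow> {\<phi> u, \<phi> v} \<in> edges H) \<and> (\<forall>v\<in>S. \<phi> v \<in> f v))
    \<longleftrightarrow> ((\<forall>v\<in>S. \<phi> v \<in> f v \<inter> verts H) \<and>
      (\<forall>u\<in>S. \<forall>v\<in>S. (u, v) \<in> adjacency G \<longrightarrow> (\<phi> u, \<phi> v) \<in> adjacency H))" for \<phi>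
    using assms by (auto simp: adjacency_def subset_iff image_subset_iff)
  then show ?thesis
    by (simp add: list_colorable_def colourable_def induced_subgraph_def)
qed

lemma induced_subgraph_verts: "simple_graph G \<Longrightarrow> induced_subgraph G (verts G) = G"
  by (cases G) (auto simp: induced_subgraph_def simple_graph_def)

lemma induced_emb_induced_subgraph:
  assumes "S \<subseteq> verts G"
  shows "induced_emb id (induced_subgraph G S) G"
  using assms by (auto simp: induced_emb_def induced_subgraph_def)

lemma has_induced_induced_subgraph:
  assumes "S \<subseteq> verts G" "has_induced (induced_subgraph G S) F"
  shows "has_induced G F"
proof -
  obtain \<sigma> where "induced_emb \<sigma> F (induced_subgraph G S)"
    using assms(2) by (auto simp: has_induced_def)
  then have "induced_emb \<sigma> F G"
    using assms(1) by (auto simp: induced_emb_def induced_subgraph_def image_subset_iff)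
  then show ?thesis by (auto simp: has_induced_def)
qed

lemma path_biclique_free_induced_subgraph:
  assumes "G \<in> path_biclique_free k t" "S \<subseteq> verts G"
  shows "induced_subgraph G S \<in> path_biclique_free k t"
proof -
  have "simple_graph (induced_subgraph G S)"
    using assms by (auto simp: path_biclique_free_def simple_graph_def induced_subgraph_def intro: finite_subset)
  then show ?thesis
    using assms(1) by (auto simp: path_biclique_free_def dest: has_induced_induced_subgraph[OF assms(2)])
qed

lemma has_induced_path_graph:
  assumes "induced_path (adjacency G) (verts G) k"
  shows "has_induced G (path_graph k)"
proof -
  obtain g where g: "inj_on g {..<k}" "g ` {..<k} \<subseteq> verts G"
      "\<forall>i<k. \<forall>j<k. (g i, g j) \<in> adjacency G \<longleftrightarrow> j = Suc i \<or> i = Suc j"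
    using assms unfolding induced_path_def by (elim exE conjE)
  have path: "{i, j} \<in> edges (path_graph k) \<longleftrightarrow> j = Suc i \<or> i = Suc j" if "i < k" "j < k" for i j
    using that by (auto simp: path_graph_def doubleton_eq_iff)
  have "{i, j} \<in> edges (path_graph k) \<longleftrightarrow> {g i, g j} \<in> edges G" if "i < k" "j < k" for i j
  proof -
    have "g i \<in> verts G" "g j \<in> verts G" using g(2) that by auto
    then have "{g i, g j} \<in> edges G \<longleftrightarrow> (g i, g j) \<in> adjacency G" by (simp add: adjacency_def)
    then show ?thesis using g(3) path that by simp
  qed
  then have "induced_emb g (path_graph k) G"
    using g(1,2) by (auto simp: induced_emb_def path_graph_def)
  then show ?thesis by (auto simp: has_induced_def)
qed

lemma has_induced_complete_bipartite:
  assumes "A \<subseteq> verts G" "B \<subseteq> verts G" "card A = t" "card B = t" "finite A" "finite B" "A \<inter> B = {}"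
    and "A \<times> B \<subseteq> adjacency G" "A \<times> A \<inter> adjacency G = {}" "B \<times> B \<inter> adjacency G = {}"
  shows "has_induced G (complete_bipartite t)"
proof -
  obtain a where a: "bij_betw a {..<t} A"
    using ex_bij_betw_nat_finite[OF assms(5)] assms(3) by (auto simp: atLeast0LessThan)
  obtain b where b: "bij_betw b {..<t} B"
    using ex_bij_betw_nat_finite[OF assms(6)] assms(4) by (auto simp: atLeast0LessThan)
  have ab: "a i \<in> A" "b i \<in> B" if "i < t" for i
    using a b that by (auto simp: bij_betw_def)
  have adj: "{u, v} \<in> edges G \<longleftrightarrow> (u, v) \<in> adjacency G" if "u \<in> A \<union> B" "v \<in> A \<union> B" for u v
    using that assms(1,2) by (auto simp: adjacency_def)
  have AB: "(a i, b j) \<in> adjacency G" "(b j, a i) \<in> adjacency G"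
      "(a i, a j) \<notin> adjacency G" "(b i, b j) \<notin> adjacency G" if "i < t" "j < t" for i j
  proof -
    have in_AB: "a i \<in> A" "a j \<in> A" "b i \<in> B" "b j \<in> B"
      using ab that by simp_all
    then show "(a i, b j) \<in> adjacency G" using assms(8) by blast
    then show "(b j, a i) \<in> adjacency G" by (rule symD[OF sym_adjacency])
    show "(a i, a j) \<notin> adjacency G" "(b i, b j) \<notin> adjacency G"
      using in_AB assms(9,10) by blast+
  qed
  have ne: "a i \<noteq> b j" if "i < t" "j < t" for i j
    using ab that assms(7) by (metis disjoint_iff)
  have inj_a: "inj_on a {..<t}" and inj_b: "inj_on b {..<t}"
    using a b by (simp_all add: bij_betw_def)
  define \<sigma> where "\<sigma> = case_sum a b"
  have "inj_on \<sigma> ({..<t} <+> {..<t})"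
  proof (rule inj_onI)
    fix u v assume "u \<in> {..<t} <+> {..<t}" "v \<in> {..<t} <+> {..<t}" "\<sigma> u = \<sigma> v"
    then show "u = v"
      using ne ne[symmetric] inj_a inj_b by (auto simp: \<sigma>_def inj_on_eq_iff)
  qed
  moreover have "\<sigma> ` ({..<t} <+> {..<t}) \<subseteq> verts G"
    using ab assms(1,2) by (auto simp: \<sigma>_def)
  moreover have "{u, v} \<in> edges (complete_bipartite t) \<longleftrightarrow> {\<sigma> u, \<sigma> v} \<in> edges G"
    if "u \<in> {..<t} <+> {..<t}" "v \<in> {..<t} <+> {..<t}" for u v
    using that ab AB by (auto simp: \<sigma>_def adj complete_bipartite_def doubleton_eq_iff)
  ultimately have "induced_emb \<sigma> (complete_bipartite t) G"
    unfolding induced_emb_def by (simp add: complete_bipartite_def)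
  then show ?thesis by (auto simp: has_induced_def)
qed

text \<open>Pigeonhole: colour classes all smaller than \<open>t\<close> would have total size below
  \<open>card D * t\<close>.\<close>

lemma monochromatic_subset:
  assumes "card A = card D * t" "col ` A \<subseteq> D" "finite D" "D \<noteq> {}" "t > 0"
  obtains A' c where "A' \<subseteq> A" "card A' = t" "finite A'" "\<And>a. a \<in> A' \<Longrightarrow> col a = c"
proof -
  have "card A > 0" using assms by (simp add: card_gt_0_iff)
  then have "finite A" using card_ge_0_finite by blast
  have "\<exists>c\<in>D. t \<le> card {a \<in> A. col a = c}"
  proof (rule ccontr)
    assume "\<not> ?thesis"
    then have less: "card {a \<in> A. col a = c} < t" if "c \<in> D" for c
      using that by (auto simp: not_le)
    have "(\<Union>c\<in>D. {a \<in> A. col a = c}) = A" using assms(2) by auto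
    then have "card A \<le> (\<Sum>c\<in>D. card {a \<in> A. col a = c})"
      using card_UN_le[OF assms(3), of "\<lambda>c. {a \<in> A. col a = c}"] by (simp only:)
    also have "\<dots> < (\<Sum>c\<in>D. t)"
      by (rule sum_strict_mono[OF assms(3,4)]) (rule less)
    finally show False using assms(1) by simp
  qed
  then obtain c where "t \<le> card {a \<in> A. col a = c}" by blast
  then obtain A' where A': "A' \<subseteq> {a \<in> A. col a = c}" "card A' = t" "finite A'"
    by (rule obtain_subset_with_card_n)
  show thesis
    by (rule that[of A' c]) (use A' in auto)
qed

text \<open>A minimal uncolourable set \<open>S\<close> becomes colourable after deleting a vertex; one extra colour for
  that vertex makes this a proper colouring of \<open>S\<close> with boundedly many colours, so that a large
  biclique contains a large induced one.\<close>

lemma bounded_obstruction: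
  fixes H :: "'h ugraph"
  assumes H: "simple_graph H" and "t > 0"
  shows "\<exists>N. \<forall>(G :: 'a ugraph) f. G \<in> path_biclique_free k t \<longrightarrow> \<not> list_colorable H (G, f) \<longrightarrow>
    (\<exists>T\<subseteq>verts G. card T \<le> N \<and> \<not> list_colorable H (induced_subgraph G T, f))"
proof -
  define D :: "'h option set" where "D = insert None (Some ` verts H)"
  have finH: "finite (verts H)" using H by (simp add: simple_graph_def)
  have D: "finite D" "D \<noteq> {}" using finH by (simp_all add: D_def)
  \<comment> \<open>Bicliques of this size retain \<open>t\<close> vertices of one colour on each
    side. Since \<open>p\<close> depends on \<open>H\<close>, \<open>k\<close> and \<open>t\<close>
    but not on \<open>G\<close>, the bound \<open>N\<close> is uniform.\<close>
  obtain p where p: "\<And>(E :: 'a rel) q. sym E \<Longrightarrow> irrefl E \<Longrightarrow> inj_on q {..p} \<Longrightarrow>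
      \<forall>i<p. (q i, q (Suc i)) \<in> E \<Longrightarrow>
      induced_path E (q ` {..p}) k \<or> biclique E (q ` {..p}) (card D * t)"
    using long_path_imp_induced_path_or_biclique[of k "card D * t"] by metis
  define N where "N = obstruction_bound (card (verts H)) p"
  have "\<exists>T\<subseteq>verts G. card T \<le> N \<and> \<not> list_colorable H (induced_subgraph G T, f)"
    if G: "G \<in> path_biclique_free k t" and not_col: "\<not> list_colorable H (G, f)"
    for G :: "'a ugraph" and f
  proof -
    let ?E = "adjacency G" and ?R = "adjacency H" and ?L = "\<lambda>v. f v \<inter> verts H"
    have simple: "simple_graph G" and no_path: "\<not> has_induced G (path_graph k)"
      and no_biclique: "\<not> has_induced G (complete_bipartite t)"
      using G by (auto simp: path_biclique_free_def)
    have E: "sym ?E" "irrefl ?E" and R: "sym ?R" "irrefl ?R"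
      using sym_adjacency irrefl_adjacency simple H by auto
    define \<A> where "\<A> = {S. S \<subseteq> verts G \<and> \<not> colourable ?E ?R ?L S}"
    have "verts G \<in> \<A>"
      using not_col list_colorable_iff_colourable[of "verts G" G H f] induced_subgraph_verts[OF simple]
      by (simp add: \<A>_def)
    moreover have "finite \<A>"
      using simple by (simp add: \<A>_def simple_graph_def)
    ultimately obtain S where S: "S \<in> \<A>" "\<forall>S'\<in>\<A>. S' \<subseteq> S \<longrightarrow> S = S'"
      using finite_has_minimal[of \<A>] by blast
    then have S_sub: "S \<subseteq> verts G" and S_not: "\<not> colourable ?E ?R ?L S"
      by (auto simp: \<A>_def)
    have S_min: "colourable ?E ?R ?L S'" if "S' \<subset> S" for S'
      using S(2) that S_sub by (auto simp: \<A>_def)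
    obtain r where r: "r \<in> S" "\<not> colourable ?E ?R ?L (component ?E S r)"
      by (rule not_colourable_component[OF E(1) S_not])
    \<comment> \<open>A proper subset of \<open>S\<close> is colourable, so the uncolourable
      component is all of \<open>S\<close> and \<open>S\<close> is connected.\<close>
    have "component ?E S r = S"
      using S_min[of "component ?E S r"] r(2) component_subset[OF r(1)] by blast
    then have conn: "(r, v) \<in> (Restr ?E S)\<^sup>*" if "v \<in> S" for v
      using that by (auto simp: component_def)
    obtain \<phi> where \<phi>: "\<And>v. v \<in> S - {r} \<Longrightarrow> \<phi> v \<in> ?L v"
        "\<And>u v. u \<in> S - {r} \<Longrightarrow> v \<in> S - {r} \<Longrightarrow> (u, v) \<in> ?E \<Longrightarrow> (\<phi> u, \<phi> v) \<in> ?R"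
      using S_min[of "S - {r}"] r(1) unfolding colourable_def by blast
    define col where "col v = (if v = r then None else Some (\<phi> v))" for v
    have col: "col ` S \<subseteq> D"
      using \<phi>(1) by (auto simp: col_def D_def)
    have proper: "(u, v) \<notin> ?E" if "u \<in> S" "v \<in> S" "col u = col v" for u v
    proof
      assume uv: "(u, v) \<in> ?E"
      then have "u \<noteq> v" using E(2) by (auto simp: irrefl_def)
      then have "u \<noteq> r" "v \<noteq> r" "\<phi> u = \<phi> v" using that(3) by (auto simp: col_def split: if_splits)
      then have "(\<phi> u, \<phi> u) \<in> ?R" using \<phi>(2)[of u v] that uv by simp
      then show False using R(2) by (auto simp: irrefl_def)
    qed
    have "\<not> path_from ?E S r p"
    proof
      assume "path_from ?E S r p"
      then obtain q where q: "inj_on q {..p}" "q ` {..p} \<subseteq> S" "\<forall>i<p. (q i, q (Suc i)) \<in> ?E"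
        unfolding path_from_def by (elim exE conjE)
      from p[OF E q(1,3)] show False
      proof
        assume "induced_path ?E (q ` {..p}) k"
        then have "induced_path ?E (verts G) k"
          by (rule induced_path_mono) (use q(2) S_sub in blast)
        then show False using has_induced_path_graph no_path by blast
      next
        assume "biclique ?E (q ` {..p}) (card D * t)"
        then obtain A B where AB: "A \<subseteq> q ` {..p}" "B \<subseteq> q ` {..p}" "card A = card D * t"
            "card B = card D * t" "A \<inter> B = {}" "A \<times> B \<subseteq> ?E"
          unfolding biclique_def by (elim exE conjE)
        have AS: "A \<subseteq> S" and BS: "B \<subseteq> S" using AB(1,2) q(2) by auto
        obtain A' c where A': "A' \<subseteq> A" "card A' = t" "finite A'" "\<And>a. a \<in> A' \<Longrightarrow> col a = c"
          using monochromatic_subset[OF AB(3) _ D \<open>t > 0\<close>, of col] col AS by (metis image_mono order_trans)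
        obtain B' d where B': "B' \<subseteq> B" "card B' = t" "finite B'" "\<And>b. b \<in> B' \<Longrightarrow> col b = d"
          using monochromatic_subset[OF AB(4) _ D \<open>t > 0\<close>, of col] col BS by (metis image_mono order_trans)
        have "has_induced G (complete_bipartite t)"
        proof (rule has_induced_complete_bipartite)
          have "(a, b) \<notin> ?E" if "a \<in> A'" "b \<in> A'" for a b
            using proper[of a b] A'(4)[OF that(1)] A'(4)[OF that(2)] A'(1) AS that by auto
          then show "A' \<times> A' \<inter> ?E = {}" by auto
          have "(a, b) \<notin> ?E" if "a \<in> B'" "b \<in> B'" for a b
            using proper[of a b] B'(4)[OF that(1)] B'(4)[OF that(2)] B'(1) BS that by auto
          then show "B' \<times> B' \<inter> ?E = {}" by auto
          show "A' \<times> B' \<subseteq> ?E" "A' \<inter> B' = {}" using AB(5,6) A'(1) B'(1) by auto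
          show "A' \<subseteq> verts G" "B' \<subseteq> verts G" using AS BS A'(1) B'(1) S_sub by auto
        qed (use A' B' in simp_all)
        with no_biclique show False by simp
      qed
    qed
    then obtain T where T: "T \<subseteq> S" "card T \<le> N" "\<not> colourable ?E ?R ?L T"
      using small_obstruction_if_no_long_path[OF E R(1) finH r(1) conn _ _ S_not] unfolding N_def by blast
    then have "T \<subseteq> verts G" using S_sub by blast
    with T show ?thesis using list_colorable_iff_colourable by blast
  qed
  then show ?thesis by blast
qed

section \<open>Counting isomorphism classes\<close>

lemma lgraph_iso_relabel:
  assumes simple: "simple_graph (fst X)" and \<sigma>: "bij_betw \<sigma> (verts (fst X)) V"
    and g: "\<And>v. v \<in> verts (fst X) \<Longrightarrow> g (\<sigma> v) = snd X v"
  shows "lgraph_iso X (\<lparr>verts = V, edges = (`) \<sigma> ` edges (fst X)\<rparr>, g)"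
proof -
  have inj: "inj_on \<sigma> (verts (fst X))" using \<sigma> by (simp add: bij_betw_def)
  have "{u, v} \<in> edges (fst X) \<longleftrightarrow> {\<sigma> u, \<sigma> v} \<in> (`) \<sigma> ` edges (fst X)"
    if "u \<in> verts (fst X)" "v \<in> verts (fst X)" for u v
  proof -
    have "\<sigma> ` {u, v} = \<sigma> ` e \<longleftrightarrow> {u, v} = e" if "e \<in> edges (fst X)" for e
      using inj_on_image_eq_iff[OF inj, of "{u, v}" e] simple that \<open>u \<in> _\<close> \<open>v \<in> _\<close>
      by (simp add: simple_graph_def)
    then show ?thesis by auto
  qed
  then show ?thesis
    unfolding lgraph_iso_def using \<sigma> g by (intro exI[of _ \<sigma>]) simp
qed

lemma finite_bounded_quotient:
  fixes \<X> :: "(nat, 'q) lgraph set"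
  assumes "finite Q"
    and \<X>: "\<And>X. X \<in> \<X> \<Longrightarrow> simple_graph (fst X) \<and> card (verts (fst X)) \<le> N \<and> snd X ` verts (fst X) \<subseteq> Q"
  shows "finite (\<X> // lgraph_iso_rel)"
proof -
  \<comment> \<open>Labels outside the vertex set are pinned to \<open>undefined\<close>; otherwise
    irrelevant values would make the set of representatives infinite.\<close>
  define Lab :: "(nat \<Rightarrow> 'q) set" where
    "Lab = {g. \<forall>v. (v \<in> {..<N} \<longrightarrow> g v \<in> insert undefined Q) \<and> (v \<notin> {..<N} \<longrightarrow> g v = undefined)}"
  have "finite Lab"
    unfolding Lab_def by (rule finite_set_of_finite_funs) (use assms(1) in simp_all)
  define Rep :: "(nat, 'q) lgraph set" where
    "Rep = (\<lambda>(V, Es, g). (\<lparr>verts = V, edges = Es\<rparr>, g)) ` (Pow {..<N} \<times> Pow (Pow {..<N}) \<times> Lab)"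
  have "finite Rep" unfolding Rep_def using \<open>finite Lab\<close> by simp
  have "\<exists>Y\<in>Rep. lgraph_iso X Y" if "X \<in> \<X>" for X
  proof -
    let ?V = "verts (fst X)"
    have X: "simple_graph (fst X)" "card ?V \<le> N" "snd X ` ?V \<subseteq> Q" using \<X>[OF that] by auto
    then have "finite ?V" by (simp add: simple_graph_def)
    then obtain \<sigma> where \<sigma>: "bij_betw \<sigma> ?V {0..<card ?V}"
      using ex_bij_betw_finite_nat by blast
    define g where "g i = (if i < card ?V then snd X (inv_into ?V \<sigma> i) else undefined)" for i
    have inv: "inv_into ?V \<sigma> i \<in> ?V" if "i < card ?V" for i
      using \<sigma> that by (auto simp: bij_betw_def intro!: inv_into_into)
    have "g (\<sigma> v) = snd X v" if "v \<in> ?V" for v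
      using \<sigma> that by (auto simp: g_def bij_betw_def)
    then have "lgraph_iso X (\<lparr>verts = {0..<card ?V}, edges = (`) \<sigma> ` edges (fst X)\<rparr>, g)"
      by (rule lgraph_iso_relabel[OF X(1) \<sigma>])
    moreover have "g \<in> Lab"
      using inv X(2,3) by (auto simp: Lab_def g_def)
    moreover have V: "{0..<card ?V} \<subseteq> {..<N}" using X(2) by auto
    moreover have "(`) \<sigma> ` edges (fst X) \<subseteq> Pow {..<N}"
    proof (rule image_subsetI)
      fix e assume "e \<in> edges (fst X)"
      then have "e \<subseteq> ?V" using X(1) by (simp add: simple_graph_def)
      then have "\<sigma> ` e \<subseteq> {0..<card ?V}" using \<sigma> by (auto simp: bij_betw_def)
      with V show "\<sigma> ` e \<in> Pow {..<N}" by blast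
    qed
    ultimately show ?thesis
      unfolding Rep_def by (intro bexI[OF _ image_eqI[OF refl]]) auto
  qed
  \<comment> \<open>Each class is the class of some element of \<open>Rep\<close>, which itself may
    lie outside \<open>\<X>\<close>.\<close>
  then have "\<X> // lgraph_iso_rel \<subseteq> (\<lambda>Y. lgraph_iso_rel `` {Y}) ` Rep"
    using equiv_class_eq[OF equiv_lgraph_iso_rel] by (fastforce simp: quotient_def lgraph_iso_rel_def)
  then show ?thesis using \<open>finite Rep\<close> by (meson finite_imageI finite_subset)
qed

text \<open>Treats both orders at once. A minimal \<open>(G, f)\<close> lies above its restriction
  to a bounded obstruction \<open>T\<close>, so by minimality it also lies below it. The resulting
  injection of \<open>verts G\<close> into \<open>T\<close> bounds the size of
  \<open>G\<close>.\<close>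

lemma finite_minimal_quotient:
  fixes H :: "'h ugraph" and le :: "(nat, 'h set) lgraph \<Rightarrow> (nat, 'h set) lgraph \<Rightarrow> bool"
  assumes H: "simple_graph H" and "t > 0" and Q: "Q \<subseteq> Pow (verts H)"
    and restrict: "\<And>G f S. S \<subseteq> verts G \<Longrightarrow> le (induced_subgraph G S, f) (G, f)"
    and inj: "\<And>X Y. le X Y \<Longrightarrow> \<exists>\<sigma>. inj_on \<sigma> (verts (fst X)) \<and> \<sigma> ` verts (fst X) \<subseteq> verts (fst Y)"
  shows "finite ({X. minimal_wrt le
      (\<lambda>Y. Y \<in> labeled_class (path_biclique_free k t) Q \<and> \<not> list_colorable H Y) X} // lgraph_iso_rel)"
proof -
  let ?P = "\<lambda>Y. Y \<in> labeled_class (path_biclique_free k t) Q \<and> \<not> list_colorable H Y"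
  obtain N where N: "\<And>(G :: nat ugraph) f. G \<in> path_biclique_free k t \<Longrightarrow> \<not> list_colorable H (G, f) \<Longrightarrow>
    \<exists>T\<subseteq>verts G. card T \<le> N \<and> \<not> list_colorable H (induced_subgraph G T, f)"
    using bounded_obstruction[OF H \<open>t > 0\<close>, of k] by blast
  have "finite Q"
    using Q H by (meson finite_Pow_iff finite_subset simple_graph_def)
  moreover have "simple_graph (fst X) \<and> card (verts (fst X)) \<le> N \<and> snd X ` verts (fst X) \<subseteq> Q"
    if "X \<in> {X. minimal_wrt le ?P X}" for X
  proof -
    obtain G f where X: "X = (G, f)" by (cases X)
    have P: "?P (G, f)" and minimal: "\<And>Y. ?P Y \<Longrightarrow> le Y (G, f) \<Longrightarrow> le (G, f) Y"
      using that unfolding X minimal_wrt_def by blast+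
    then have G: "G \<in> path_biclique_free k t" "f ` verts G \<subseteq> Q" "\<not> list_colorable H (G, f)"
      by (auto simp: labeled_class_def)
    then have simple: "simple_graph G" by (simp add: path_biclique_free_def)
    obtain T where T: "T \<subseteq> verts G" "card T \<le> N" "\<not> list_colorable H (induced_subgraph G T, f)"
      using N[OF G(1,3)] by blast
    have "f ` verts (induced_subgraph G T) \<subseteq> Q"
      using T(1) G(2) by (auto simp: induced_subgraph_def)
    then have "?P (induced_subgraph G T, f)"
      using T path_biclique_free_induced_subgraph[OF G(1) T(1)] by (simp add: labeled_class_def)
    then have "le (G, f) (induced_subgraph G T, f)"
      using minimal restrict[OF T(1)] by blast
    from inj[OF this] obtain \<sigma> where "inj_on \<sigma> (verts G)" "\<sigma> ` verts G \<subseteq> T"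
      by (auto simp: induced_subgraph_def)
    moreover have "finite T"
      using T(1) simple finite_subset by (auto simp: simple_graph_def)
    ultimately have "card (verts G) \<le> card T"
      by (rule card_inj_on_le)
    with T(2) simple G(2) X show ?thesis by simp
  qed
  ultimately show ?thesis by (rule finite_bounded_quotient)
qed

theorem theorem1:
  fixes H :: "'h ugraph" and k t :: nat and Q :: "'h set set"
  assumes "simple_graph H" and "k > 0" and "t > 0" and "Q \<subseteq> Pow (verts H)"
  shows "finite ({X :: (nat, 'h set) lgraph.
             minimal_wrt (lgraph_induced_le list_le)
               (\<lambda>Y. Y \<in> labeled_class (path_biclique_free k t) Q \<and> \<not> list_colorable H Y) X}
           // lgraph_iso_rel)
       \<and> finite ({X :: (nat, 'h set) lgraph.
             minimal_wrt (lgraph_subgraph_le list_le)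
               (\<lambda>Y. Y \<in> labeled_class (path_biclique_free k t) Q \<and> \<not> list_colorable H Y) X}
           // lgraph_iso_rel)"
proof (intro conjI; rule finite_minimal_quotient[OF assms(1,3,4)])
  fix G :: "nat ugraph" and f :: "nat \<Rightarrow> 'h set" and S assume "S \<subseteq> verts G"
  then have emb: "induced_emb id (induced_subgraph G S) G"
    by (rule induced_emb_induced_subgraph)
  then show "lgraph_induced_le list_le (induced_subgraph G S, f) (G, f)"
    by (auto simp: lgraph_induced_le_def list_le_def intro!: exI[of _ id])
  from emb show "lgraph_subgraph_le list_le (induced_subgraph G S, f) (G, f)"
    by (auto simp: lgraph_subgraph_le_def list_le_def induced_emb_def subgraph_emb_def intro!: exI[of _ id])
qed (auto simp: lgraph_induced_le_def lgraph_subgraph_le_def induced_emb_def subgraph_emb_def)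

end
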